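(* Let $t_0$ be a fixed interior point of $J$ and let $x_n=x_{b,n}+v_n$, $p$, $d_n$, $\tilde v_n(\cdot;t_0)$, $g_n$, $y_n$ be as in the context. Suppose that: (A1) there is a stochastic process $\tilde v(\cdot;t_0)\neq 0$ such that $\tilde v_n(\cdot;t_0)\xrightarrow{\mathcal L}\tilde v(\cdot;t_0)$ on $D(-\infty,\infty)$ as $n\to\infty$; (A2) the functions $x_{b,n}$, $n\ge1$, are convex, and there is a constant $A>0$ such that for each $c>0$, $\sup_{|s|\le c}|g_n(s)-A|s|^p|\to0$ as $n\to\infty$; (A3) for every $\delta>0$ there are finite $\tau=\tau(\delta)>0$ and $\kappa=\kappa(\delta)>0$ such that $\liminf_{n\to\infty}P\left(\inf_{|s|\ge\tau}(y_n(s)-\kappa|s|)>0\right)>1-\delta$; (A4) given $\varepsilon,\delta,\tilde\tau>0$, for all large enough $c>0$, $$\limsup_{n\to\infty}P\left(\inf_{\tilde\tau\le s\le c}\frac{y_n(s)}{s}-\inf_{\tilde\tau\le s}\frac{y_n(s)}{s}>\varepsilon\right)<\delta,\qquad \limsup_{n\to\infty}P\left(\sup_{-c\le s\le-\tilde\tau}\frac{y_n(s)}{s}-\sup_{s\le-\tilde\tau}\frac{y_n(s)}{s}<-\varepsilon\right)<\delta;$$ (A5) for each $\varepsilon,\delta>0$ there is $\tau=\tau(\varepsilon,\delta)>0$ such that $P\left(\sup_{|s|\ge\tau}\left|\frac{\tilde v(s;t_0)}{A|s|^p}\right|>\varepsilon\right)\le\delta$. Then, as $n\to\infty$, $$d_n^{-p}\,[T_J(x_n)(t_0)-x_n(t_0)]\xrightarrow{\mathcal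 L}T\left[A|s|^p+\tilde v(s;t_0)\right](0),$$ with $A$ the constant in (A2).
   Context: $J\subset\mathbb R$ is a finite or infinite interval; $D(J)$ is the space of functions $J\to\mathbb R$ that are right continuous with left-hand limits. For an interval $O$ and a function $x$ on $O$, $T_O(x)=\sup\{z: z:O\to\mathbb R \text{ convex}, z\le x\}$ (pointwise supremum) is the greatest convex minorant of $x$ on $O$; $T=T_{\mathbb R}$. $\{x_n\}_{n\ge1}$ is a sequence of stochastic processes in $D(J)$, a.s. bounded from below on $J$, with $x_n(t)=x_{b,n}(t)+v_n(t)$, $t\in J$, where $x_{b,n}$ is deterministic and $v_n\in D(J)$ is a stochastic process. $1<p<\infty$ is a fixed constant and $d_n\downarrow0$ a fixed sequence. Put $J_{n,t_0}=d_n^{-1}(J-t_0)$ and, for $s\in J_{n,t_0}$, $$\tilde v_n(s;t_0)=d_n^{-p}(v_n(t_0+sd_n)-v_n(t_0)),$$ $$g_n(s)=d_n^{-p}\left(x_{b,n}(t_0+sd_n)-x_{b,n}(t_0)-x_{b,n}'(t_0)sd_n\right),\qquad y_n(s)=g_n(s)+\tilde v_n(s;t_0).$$ When regarded as an element of $D(-\infty,\infty)$, $\tilde v_n(\cdot;t_0)$ is extended from $J_{n,t_0}$ to $\mathbb R$ by constants beyond the endpoints of $J_{n,t_0}$. Infima and suprema of expressions involving $y_n$ are over $s$ in the domain $J_{n,t_0}$ of $y_n$. $D(-\infty,\infty)=D(\mathbb R)$ carries the metric $\rho(x,y)=\sum_{k\ge1}2^{-k}\rho_k(x,y)/(1+\rho_k(x,y))$,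 $\rho_k(x,y)=\sup_{s\in[-k,k]}|x(s)-y(s)|$ (uniform convergence on compacta), and the $\sigma$-algebra generated by the open balls; $\xrightarrow{\mathcal L}$ denotes weak convergence (convergence in distribution). *)

theory Defs
  imports "HOL-Probability.Probability"
begin

text \<open>
  Functions on an interval \<open>J\<close> are total functions whose values outside \<open>J\<close> are ignored.
  At an endpoint of \<open>J\<close> the one-sided condition pointing out of \<open>J\<close> holds vacuously,
  because the corresponding filter is trivial.
\<close>

definition cadlag :: "real set \<Rightarrow> (real \<Rightarrow> real) set" where
  "cadlag J = {x. \<forall>t\<in>J. (x \<longlongrightarrow> x t) (at t within J \<inter> {t<..}) \<and>
                         (\<exists>l. (x \<longlongrightarrow> l) (at t within J \<inter> {..<t}))}"

text \<open>
  The real supremum below has an unspecified value when \<open>x\<close> has no convex minorant on \<open>J\<close>;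
  it is the greatest convex minorant whenever one exists.
\<close>

definition gcm :: "real set \<Rightarrow> (real \<Rightarrow> real) \<Rightarrow> real \<Rightarrow> real" where
  "gcm J x t = (SUP z\<in>{z. convex_on J z \<and> (\<forall>s\<in>J. z s \<le> x s)}. z t)"


definition unif_dist :: "nat \<Rightarrow> (real \<Rightarrow> real) \<Rightarrow> (real \<Rightarrow> real) \<Rightarrow> real" where
  "unif_dist k x y = (SUP s\<in>{- real k..real k}. \<bar>x s - y s\<bar>)"

text \<open>
  The index is shifted so that the sum runs over the compact intervals with \<open>k \<ge> 1\<close>.
  The value 0 off the space only serves the requirement of \<^locale>\<open>Metric_space\<close> that a
  distance be nonnegative for arbitrary arguments.
\<close>

definition loc_unif_dist :: "(real \<Rightarrow> real) \<Rightarrow> (real \<Rightarrow> real) \<Rightarrow> real" where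
  "loc_unif_dist x y =
     (if x \<in> cadlag UNIV \<and> y \<in> cadlag UNIV
      then \<Sum>k. (1/2) ^ Suc k * (unif_dist (Suc k) x y / (1 + unif_dist (Suc k) x y))
      else 0)"

lemma cadlag_bounded:
  assumes x: "x \<in> cadlag UNIV"
  shows "\<exists>B. \<forall>s\<in>{a..b}. \<bar>x s\<bar> \<le> B"
proof (cases "a \<le> b")
  case True
  then show ?thesis
  proof (induction rule: Bolzano)
    case (trans a b c)
    then obtain B C where "\<forall>s\<in>{a..b}. \<bar>x s\<bar> \<le> B" "\<forall>s\<in>{b..c}. \<bar>x s\<bar> \<le> C" by blast
    then have "\<forall>s\<in>{a..c}. \<bar>x s\<bar> \<le> max B C"
      by (metis atLeastAtMost_iff le_max_iff_disj linear)
    then show ?case by blast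
  next
    case (local t)
    from x obtain l where r: "(x \<longlongrightarrow> x t) (at_right t)" and l: "(x \<longlongrightarrow> l) (at_left t)"
      by (auto simp: cadlag_def)
    have "\<forall>\<^sub>F s in at_right t. \<bar>x s - x t\<bar> < 1"
      using tendstoD[OF r, of 1] by (simp add: dist_real_def)
    then obtain u where u: "t < u" "\<And>s. t < s \<Longrightarrow> s < u \<Longrightarrow> \<bar>x s - x t\<bar> < 1"
      by (auto simp: eventually_at_right_field)
    have "\<forall>\<^sub>F s in at_left t. \<bar>x s - l\<bar> < 1"
      using tendstoD[OF l, of 1] by (simp add: dist_real_def)
    then obtain w where w: "w < t" "\<And>s. w < s \<Longrightarrow> s < t \<Longrightarrow> \<bar>x s - l\<bar> < 1"
      by (auto simp: eventually_at_left_field)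
    have bd: "\<bar>x s\<bar> \<le> \<bar>x t\<bar> + \<bar>l\<bar> + 1" if "w < s" "s < u" for s
      using u(2)[of s] w(2)[of s] that by (cases s t rule: linorder_cases) auto
    have "\<exists>B. \<forall>s\<in>{a..b}. \<bar>x s\<bar> \<le> B"
      if "a \<le> t \<and> t \<le> b \<and> b - a < min (u - t) (t - w)" for a b
      using that by (intro exI[of _ "\<bar>x t\<bar> + \<bar>l\<bar> + 1"] ballI bd) auto
    moreover have "0 < min (u - t) (t - w)" using u w by simp
    ultimately show ?case by blast
  qed
qed auto

lemma bdd_above_unif_dist:
  assumes "x \<in> cadlag UNIV" "y \<in> cadlag UNIV"
  shows "bdd_above ((\<lambda>s. \<bar>x s - y s\<bar>) ` {- real k..real k})"
proof -
  obtain B C where "\<forall>s\<in>{- real k..real k}. \<bar>x s\<bar> \<le> B" "\<forall>s\<in>{- real k..real k}. \<bar>y s\<bar> \<le> C"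
    using cadlag_bounded[OF assms(1)] cadlag_bounded[OF assms(2)] by meson
  then show ?thesis
    by (intro bdd_aboveI2[where M = "B + C"]) (smt (verit))
qed

lemma unif_dist_upper:
  assumes "x \<in> cadlag UNIV" "y \<in> cadlag UNIV" "\<bar>s\<bar> \<le> real k"
  shows "\<bar>x s - y s\<bar> \<le> unif_dist k x y"
  unfolding unif_dist_def
  using assms(3) by (intro cSUP_upper bdd_above_unif_dist assms(1,2)) auto

lemma unif_dist_nonneg:
  assumes "x \<in> cadlag UNIV" "y \<in> cadlag UNIV"
  shows "0 \<le> unif_dist k x y"
  using unif_dist_upper[OF assms, of 0 k] by simp

lemma unif_dist_triangle:
  assumes "x \<in> cadlag UNIV" "y \<in> cadlag UNIV" "z \<in> cadlag UNIV"
  shows "unif_dist k x z \<le> unif_dist k x y + unif_dist k y z"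
  unfolding unif_dist_def[of k x z]
proof (rule cSUP_least)
  fix s assume "s \<in> {- real k..real k}"
  then have "\<bar>s\<bar> \<le> real k" by auto
  then show "\<bar>x s - z s\<bar> \<le> unif_dist k x y + unif_dist k y z"
    using unif_dist_upper[OF assms(1,2)] unif_dist_upper[OF assms(2,3)] by (smt (verit))
qed simp

lemma frac_subadd:
  fixes a b c :: real
  assumes "0 \<le> a" "0 \<le> b" "0 \<le> c" "c \<le> a + b"
  shows "c / (1 + c) \<le> a / (1 + a) + b / (1 + b)"
proof -
  have "c / (1 + c) \<le> (a + b) / (1 + (a + b))"
    using assms by (simp add: frac_le_eq divide_simps) (simp add: algebra_simps)
  also have "\<dots> = a / (1 + (a + b)) + b / (1 + (a + b))"
    by (simp add: add_divide_distrib)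
  also have "\<dots> \<le> a / (1 + a) + b / (1 + b)"
    using assms by (intro add_mono divide_left_mono mult_pos_pos) auto
  finally show ?thesis .
qed

lemma summable_loc_unif_dist:
  assumes "x \<in> cadlag UNIV" "y \<in> cadlag UNIV"
  shows "summable (\<lambda>k. (1/2) ^ Suc k * (unif_dist (Suc k) x y / (1 + unif_dist (Suc k) x y)))"
proof (rule summable_comparison_test')
  show "summable (\<lambda>k. (1/2 :: real) ^ Suc k)"
    by (simp add: summable_geometric)
  fix k :: nat
  have "0 \<le> unif_dist (Suc k) x y" by (rule unif_dist_nonneg[OF assms])
  then have "0 \<le> unif_dist (Suc k) x y / (1 + unif_dist (Suc k) x y)"
    "unif_dist (Suc k) x y / (1 + unif_dist (Suc k) x y) \<le> 1" by auto
  then show "norm ((1/2) ^ Suc k * (unif_dist (Suc k) x y / (1 + unif_dist (Suc k) x y)))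
             \<le> (1/2) ^ Suc k"
    unfolding real_norm_def by (subst abs_of_nonneg) (intro mult_nonneg_nonneg mult_left_le; simp)+
qed

interpretation D: Metric_space "cadlag UNIV" loc_unif_dist
proof
  fix x y z :: "real \<Rightarrow> real"
  have term_nonneg:
    "0 \<le> (1/2) ^ Suc k * (unif_dist (Suc k) x y / (1 + unif_dist (Suc k) x y))"
    if "x \<in> cadlag UNIV" "y \<in> cadlag UNIV" for k x y
    using unif_dist_nonneg[OF that, of "Suc k"] by simp
  show "0 \<le> loc_unif_dist x y"
    using suminf_nonneg[OF summable_loc_unif_dist term_nonneg] by (simp add: loc_unif_dist_def)
  show "loc_unif_dist x y = loc_unif_dist y x"
    by (auto simp: loc_unif_dist_def unif_dist_def abs_minus_commute)
  show "loc_unif_dist x y = 0 \<longleftrightarrow> x = y" if xy: "x \<in> cadlag UNIV" "y \<in> cadlag UNIV"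
  proof
    assume "loc_unif_dist x y = 0"
    then have 0: "(1/2) ^ Suc k * (unif_dist (Suc k) x y / (1 + unif_dist (Suc k) x y)) = 0" for k
      using suminf_eq_zero_iff[OF summable_loc_unif_dist[OF xy] term_nonneg[OF xy]] xy
      by (simp add: loc_unif_dist_def)
    have u: "unif_dist (Suc k) x y = 0" for k
      using 0[of k] unif_dist_nonneg[OF xy, of "Suc k"] by auto
    show "x = y"
    proof
      fix s
      obtain k where "\<bar>s\<bar> \<le> real k" using real_arch_simple by blast
      then have "\<bar>s\<bar> \<le> real (Suc k)" by simp
      from unif_dist_upper[OF xy this] show "x s = y s" by (simp add: u)
    qed
  qed (simp add: loc_unif_dist_def unif_dist_def)
  show "loc_unif_dist x z \<le> loc_unif_dist x y + loc_unif_dist y z"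
    if xyz: "x \<in> cadlag UNIV" "y \<in> cadlag UNIV" "z \<in> cadlag UNIV"
  proof -
    have "(1/2) ^ Suc k * (unif_dist (Suc k) x z / (1 + unif_dist (Suc k) x z))
        \<le> (1/2) ^ Suc k * (unif_dist (Suc k) x y / (1 + unif_dist (Suc k) x y))
         + (1/2) ^ Suc k * (unif_dist (Suc k) y z / (1 + unif_dist (Suc k) y z))" for k
      unfolding distrib_left[symmetric]
      by (intro mult_left_mono frac_subadd unif_dist_nonneg unif_dist_triangle xyz) auto
    from suminf_le[OF this summable_loc_unif_dist[OF xyz(1,3)]
        summable_add[OF summable_loc_unif_dist[OF xyz(1,2)] summable_loc_unif_dist[OF xyz(2,3)]]]
    show ?thesis
      unfolding suminf_add[OF summable_loc_unif_dist[OF xyz(1,2)]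
          summable_loc_unif_dist[OF xyz(2,3)], symmetric]
      using xyz by (simp add: loc_unif_dist_def)
  qed
qed


text \<open>
  Weak convergence of random elements of a possibly non-separable metric space \<open>(S, \<delta>)\<close>: the
  space carries the \<open>\<sigma>\<close>-algebra generated by the open balls, which can be smaller than the
  Borel \<open>\<sigma>\<close>-algebra, so the bounded continuous test functions are also required to be
  measurable. The random elements may live on different probability spaces.
\<close>

definition ball_sigma :: "'s set \<Rightarrow> ('s \<Rightarrow> 's \<Rightarrow> real) \<Rightarrow> 's measure" where
  "ball_sigma S \<delta> = sigma S {Metric_space.mball S \<delta> x r |x r. x \<in> S}"

definition converges_in_law ::
  "'s set \<Rightarrow> ('s \<Rightarrow> 's \<Rightarrow> real) \<Rightarrow> (nat \<Rightarrow> 'a measure) \<Rightarrow> (nat \<Rightarrow> 'a \<Rightarrow> 's)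
     \<Rightarrow> 'b measure \<Rightarrow> ('b \<Rightarrow> 's) \<Rightarrow> bool" where
  "converges_in_law S \<delta> M X N Y \<longleftrightarrow>
     (\<forall>n. X n \<in> M n \<rightarrow>\<^sub>M ball_sigma S \<delta>) \<and> Y \<in> N \<rightarrow>\<^sub>M ball_sigma S \<delta> \<and>
     (\<forall>f. continuous_map (Metric_space.mtopology S \<delta>) euclideanreal f \<and> bounded (f ` S) \<and>
          f \<in> borel_measurable (ball_sigma S \<delta>) \<longrightarrow>
          (\<lambda>n. \<integral>\<omega>. f (X n \<omega>) \<partial>M n) \<longlonglongrightarrow> (\<integral>\<omega>. f (Y \<omega>) \<partial>N))"


definition local_domain :: "real set \<Rightarrow> real \<Rightarrow> real \<Rightarrow> real set" where
  "local_domain J t0 d = (\<lambda>t. (t - t0) / d) ` J"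

definition local_noise :: "real \<Rightarrow> real \<Rightarrow> real \<Rightarrow> (real \<Rightarrow> real) \<Rightarrow> real \<Rightarrow> real" where
  "local_noise p t0 d v s = d powr (- p) * (v (t0 + s * d) - v t0)"

definition local_drift :: "real \<Rightarrow> real \<Rightarrow> real \<Rightarrow> (real \<Rightarrow> real) \<Rightarrow> real \<Rightarrow> real" where
  "local_drift p t0 d f s = d powr (- p) * (f (t0 + s * d) - f t0 - deriv f t0 * s * d)"

text \<open>
  Extension of a function from an interval \<open>I\<close> to the whole line by its value at the
  endpoint; at an endpoint that does not belong to \<open>I\<close> this is the one-sided limit, the only
  constant giving a function without an extra jump.
\<close>

definition const_extension :: "real set \<Rightarrow> (real \<Rightarrow> real) \<Rightarrow> real \<Rightarrow> real" where
  "const_extension I x s =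
     (if s \<in> I then x s
      else if \<exists>u\<in>I. u < s
      then (if Sup I \<in> I then x (Sup I) else Lim (at_left (Sup I)) x)
      else (if Inf I \<in> I then x (Inf I) else Lim (at_right (Inf I)) x))"

end

theory Submission
  imports Defs
begin

text \<open>
  In one dimension the greatest convex minorant at an interior point \<open>t\<close> is the infimum of the
  values at \<open>t\<close> of all chords over \<open>s \<le> t \<le> u\<close>. Chords are compatible with the local rescaling,
  so \<open>X n\<close> is the chord infimum of \<open>y n\<close> at 0 over the rescaled interval. Restricted to
  \<open>[-c, c]\<close> this infimum is Lipschitz in the uniform norm and converges in law by (A1) and (A2);
  as \<open>c \<rightarrow> \<infinity>\<close> its limit decreases to \<open>Y\<close>, which is finite almost surely by (A5).
  The chords leaving \<open>[-c, c]\<close> do not matter: if both ends are far from 0 the chord is nonnegative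
  by (A3), and if only one is, (A4) replaces it by an end inside \<open>[-c, c]\<close> at small cost,
  since the process is tight near 0. All infima run over countable right-dense sets, so
  they are measurable.
\<close>

section \<open>Chords and the greatest convex minorant\<close>

text \<open>The obstacle is that the minorant at 0 over the whole line is not a continuous
  functional for uniform convergence on compacta: one distant dip on each side of 0 pulls it down
  arbitrarily far. Only the functionals on compact windows can serve as test functionals, so the
  error of the window must be bounded in probability. The constants are forced in this order. A3
  gives \<open>\<tau>\<close>, beyond which the path is nonnegative; tightness on a window
  containing \<open>[-\<tau>, \<tau>]\<close> gives a lower bound \<open>- (K + 1)\<close> there;
  these fix a threshold \<open>T\<close> and a slope tolerance \<open>e\<close>; only then is A4
  invoked, with \<open>T\<close> and not \<open>\<tau>\<close> as its threshold, to give the window.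
  The threshold must be large because A4 compares slopes \<open>y u / u\<close>, whereas a chord
  weights them by a factor that still varies with \<open>u\<close> when \<open>u\<close> is
  comparable to the other end.\<close>

definition chord :: "(real \<Rightarrow> real) \<Rightarrow> real \<Rightarrow> real \<Rightarrow> real \<Rightarrow> real" where
  "chord x t s u = ((u - t) * x s + (t - s) * x u) / (u - s)"

text \<open>One end may coincide with \<open>t\<close>; such a chord has the value
  \<open>x t\<close> there. The condition \<open>s < u\<close> keeps the denominator in
  \<open>chord\<close> positive.\<close>

definition chord_pairs :: "real set \<Rightarrow> real \<Rightarrow> (real \<times> real) set" where
  "chord_pairs S t = {(s, u). s \<in> S \<and> u \<in> S \<and> s \<le> t \<and> t \<le> u \<and> s < u}"

text \<open>Valued in \<open>ereal\<close>, so that at an interior point the absence of a convex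
  minorant shows as \<open>-\<infinity>\<close>, where \<open>gcm\<close> falls back on an
  unspecified real.\<close>

definition lower_hull :: "real set \<Rightarrow> (real \<Rightarrow> real) \<Rightarrow> real \<Rightarrow> ereal" where
  "lower_hull S x t = (INF (s, u)\<in>chord_pairs S t. ereal (chord x t s u))"

lemma chord_mono:
  assumes "s \<le> t" "t \<le> u" "s < u" "x s \<le> y s" "x u \<le> y u"
  shows "chord x t s u \<le> chord y t s u"
  unfolding chord_def using assms by (intro divide_right_mono add_mono mult_left_mono) auto

text \<open>Interpolation reproduces affine functions, so a linear term vanishing at
  \<open>t\<close> drops out. This removes the derivative term of
  \<open>local_drift\<close>.\<close>

lemma chord_affine:
  assumes "s < u"
  shows "chord (\<lambda>r. a * x r + b + c * (r - t)) t s u = a * chord x t s u + b"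
proof -
  have "(u - t) * (a * x s + b + c * (s - t)) + (t - s) * (a * x u + b + c * (u - t))
      = a * ((u - t) * x s + (t - s) * x u) + b * (u - s)"
    by (simp add: algebra_simps)
  then have "chord (\<lambda>r. a * x r + b + c * (r - t)) t s u
      = (a * ((u - t) * x s + (t - s) * x u) + b * (u - s)) / (u - s)"
    by (simp only: chord_def)
  also have "\<dots> = a * chord x t s u + b"
    using assms by (simp add: chord_def add_divide_distrib distrib_left)
  finally show ?thesis .
qed

lemma chord_shift: "s < u \<Longrightarrow> chord (\<lambda>r. x r + b) t s u = chord x t s u + b"
  using chord_affine[of s u 1 x b 0 t] by simp

lemma chord_ge:
  assumes "s \<le> t" "t \<le> u" "s < u" "m \<le> x s" "m \<le> x u"
  shows "m \<le> chord x t s u"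
  using chord_mono[OF assms(1-3), of "\<lambda>_. m" x] chord_affine[OF assms(3), of 0 x m 0 t] assms(4,5)
  by simp

lemma convex_on_le_chord:
  assumes z: "convex_on S z" and su: "(s, u) \<in> chord_pairs S t"
  shows "z t \<le> chord z t s u"
proof -
  define l where "l = (t - s) / (u - s)"
  have su': "s \<in> S" "u \<in> S" "s \<le> t" "t \<le> u" "s < u" using su by (auto simp: chord_pairs_def)
  have l: "0 \<le> l" "l \<le> 1" using su' by (auto simp: l_def)
  have l1: "1 - l = (u - t) / (u - s)" using su' by (simp add: l_def field_simps)
  have "l * (u - s) = t - s" using su' by (simp add: l_def)
  then have "(1 - l) * s + l * u = t" by (simp add: algebra_simps)
  then have "z t \<le> (1 - l) * z s + l * z u"
    using convex_onD[OF z l su'(1,2)] by simp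
  also have "\<dots> = chord z t s u"
    unfolding l1 unfolding l_def chord_def by (simp add: add_divide_distrib)
  finally show ?thesis .
qed

text \<open>This is the supporting line through \<open>(t, m)\<close>: the chord bounds say that
  each slope from this point to the graph on the left is at most each slope to the graph on the
  right.\<close>

lemma affine_minorant_exists:
  assumes ex: "s0 \<in> S" "s0 < t" "u0 \<in> S" "t < u0"
    and m: "\<And>s u. (s, u) \<in> chord_pairs S t \<Longrightarrow> m \<le> chord x t s u"
  shows "\<exists>a. \<forall>s\<in>S. m + a * (s - t) \<le> x s"
proof -
  have sl: "(m - x s) / (t - s) \<le> (x u - m) / (u - t)" if "s \<in> S" "u \<in> S" "s < t" "t < u" for s u
  proof -
    have "m \<le> chord x t s u" using m[of s u] that by (auto simp: chord_pairs_def)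
    then have "m * (u - s) \<le> (u - t) * x s + (t - s) * x u"
      using that by (simp add: chord_def pos_le_divide_eq)
    then show ?thesis using that by (simp add: divide_le_eq le_divide_eq field_simps)
  qed
  \<comment> \<open>Any number separating left slopes from right slopes serves; \<open>s0\<close>
    makes the set nonempty and \<open>u0\<close> bounds it.\<close>
  define a where "a = (SUP s\<in>S \<inter> {..<t}. (m - x s) / (t - s))"
  have bdd: "bdd_above ((\<lambda>s. (m - x s) / (t - s)) ` (S \<inter> {..<t}))"
    using sl[of _ u0] ex by (intro bdd_aboveI2[where M="(x u0 - m) / (u0 - t)"]) auto
  have "m + a * (s - t) \<le> x s" if s: "s \<in> S" for s
  proof (cases s t rule: linorder_cases)
    case less
    have "(m - x s) / (t - s) \<le> a"
      unfolding a_def using less s by (intro cSUP_upper bdd) auto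
    then show ?thesis using less by (simp add: divide_le_eq algebra_simps)
  next
    case equal
    \<comment> \<open>The chord from \<open>t\<close> to \<open>u0\<close> has the value
      \<open>x t\<close> at \<open>t\<close>.\<close>
    have "m \<le> chord x t t u0" using m[of t u0] s ex equal by (auto simp: chord_pairs_def)
    then show ?thesis using ex equal by (simp add: chord_def)
  next
    case greater
    have "a \<le> (x s - m) / (s - t)"
      unfolding a_def using greater s ex sl by (intro cSUP_least) auto
    then show ?thesis using greater by (simp add: le_divide_eq algebra_simps)
  qed
  then show ?thesis by blast
qed

lemma interior_real_neighbours:
  fixes S :: "real set"
  assumes "t \<in> interior S"
  obtains s u where "s \<in> S" "s < t" "u \<in> S" "t < u"
proof -
  obtain e where e: "e > 0" "ball t e \<subseteq> S" using assms by (auto simp: mem_interior)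
  have "t - e / 2 \<in> ball t e" "t + e / 2 \<in> ball t e" using e(1) by (auto simp: dist_real_def)
  then have "t - e / 2 \<in> S" "t + e / 2 \<in> S" using e(2) by blast+
  then show ?thesis using that[of "t - e/2" "t + e/2"] e(1) by simp
qed

lemma chord_pairs_nonempty: "t \<in> interior S \<Longrightarrow> chord_pairs S t \<noteq> {}"
  by (auto simp: chord_pairs_def elim!: interior_real_neighbours) (meson less_imp_le less_trans)

lemma lower_hull_lower:
  "(s, u) \<in> chord_pairs S t \<Longrightarrow> lower_hull S x t \<le> ereal (chord x t s u)"
  unfolding lower_hull_def by (intro INF_lower2[of "(s, u)"]) auto

lemma lower_hull_greatest:
  "(\<And>s u. (s, u) \<in> chord_pairs S t \<Longrightarrow> m \<le> ereal (chord x t s u)) \<Longrightarrow> m \<le> lower_hull S x t"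
  unfolding lower_hull_def by (intro INF_greatest) auto

lemma lower_hull_less_top: "t \<in> interior S \<Longrightarrow> lower_hull S x t < \<infinity>"
  using chord_pairs_nonempty[of t S] lower_hull_lower[of _ _ S t x]
  by (metis equals0I ereal_infty_less(1) ereal_less_eq(1) ex_in_conv surj_pair less_ereal.simps(4)
      order_le_less_trans)

text \<open>Convex minorants lie below every chord, and the supporting line at the height of the
  hull attains it. If the hull is \<open>-\<infinity>\<close>, there is no minorant; the value is
  then the fixed real \<open>Sup {}\<close>, so measurability of \<open>gcm\<close> needs no lower
  bound on the paths.\<close>

lemma gcm_eq_lower_hull:
  assumes S: "is_interval S" and t: "t \<in> interior S"
  shows "gcm S x t = (if lower_hull S x t = - \<infinity> then Sup {} else real_of_ereal (lower_hull S x t))"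
proof -
  let ?Z = "{z. convex_on S z \<and> (\<forall>s\<in>S. z s \<le> x s)}"
  have ub: "ereal (z t) \<le> lower_hull S x t" if "z \<in> ?Z" for z
  proof (rule lower_hull_greatest)
    fix s u assume su: "(s, u) \<in> chord_pairs S t"
    have "z t \<le> chord z t s u" using that su by (intro convex_on_le_chord) auto
    also have "\<dots> \<le> chord x t s u"
      using that su by (intro chord_mono) (auto simp: chord_pairs_def)
    finally show "ereal (z t) \<le> ereal (chord x t s u)" by simp
  qed
  show ?thesis
  proof (cases "lower_hull S x t = - \<infinity>")
    case True
    then have "?Z = {}" using ub by force
    then have "gcm S x t = Sup {}" unfolding gcm_def by (simp only: image_empty)
    then show ?thesis using True by simp
  next
    case False
    with lower_hull_less_top[OF t, of x] obtain m where m: "lower_hull S x t = ereal m"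
      by (cases "lower_hull S x t") auto
    obtain s0 u0 where "s0 \<in> S" "s0 < t" "u0 \<in> S" "t < u0" using t by (rule interior_real_neighbours)
    then obtain a where a: "\<forall>s\<in>S. m + a * (s - t) \<le> x s"
      using affine_minorant_exists[of s0 S t u0 m x] lower_hull_lower[of _ _ S t x] m by auto
    have "convex_on S (\<lambda>s. m + a * (s - t))"
      using S by (intro convex_onI) (auto simp: is_interval_convex algebra_simps)
    then have "(\<lambda>s. m + a * (s - t)) \<in> ?Z" using a by simp
    then have "(\<lambda>s. m + a * (s - t)) t \<in> (\<lambda>z. z t) ` ?Z" by (rule imageI)
    moreover have "r \<le> m" if "r \<in> (\<lambda>z. z t) ` ?Z" for r
      using that ub m by (metis (no_types, lifting) ereal_less_eq(3) imageE)
    ultimately have "(SUP z\<in>?Z. z t) = m"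
      by (intro cSup_eq_maximum) simp_all
    then show ?thesis using False m by (simp add: gcm_def)
  qed
qed

lemma ereal_gcm:
  assumes "is_interval S" "t \<in> interior S" "lower_hull S x t \<noteq> - \<infinity>"
  shows "ereal (gcm S x t) = lower_hull S x t"
  using gcm_eq_lower_hull[OF assms(1,2), of x] lower_hull_less_top[OF assms(2), of x] assms(3)
  by (cases "lower_hull S x t") auto

lemma gcm_greatest:
  assumes "is_interval S" "t \<in> interior S"
    and "\<And>s u. (s, u) \<in> chord_pairs S t \<Longrightarrow> m \<le> chord x t s u"
  shows "m \<le> gcm S x t"
proof -
  have "ereal m \<le> lower_hull S x t" using assms(3) by (intro lower_hull_greatest) auto
  then show ?thesis using ereal_gcm[OF assms(1,2), of x] by (metis MInfty_neq_ereal(1) ereal_infty_less_eq(2) ereal_less_eq(3))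
qed

text \<open>The common bound \<open>m\<close> excludes the default \<open>Sup {}\<close>, which need
  not lie below a chord.\<close>

lemma gcm_lower:
  assumes "is_interval S" "t \<in> interior S"
    and "\<And>s u. (s, u) \<in> chord_pairs S t \<Longrightarrow> m \<le> chord x t s u"
    and su: "(s, u) \<in> chord_pairs S t"
  shows "gcm S x t \<le> chord x t s u"
proof -
  have "ereal m \<le> lower_hull S x t" using assms(3) by (intro lower_hull_greatest) auto
  then have "ereal (gcm S x t) = lower_hull S x t"
    by (intro ereal_gcm assms(1,2)) auto
  then show ?thesis using lower_hull_lower[OF su, of x] by (metis ereal_less_eq(3))
qed

lemma gcm_le_gcm_add:
  assumes S: "is_interval S" "t \<in> interior S"
    and m: "\<And>s. s \<in> S \<Longrightarrow> m \<le> x s" and xy: "\<And>s. s \<in> S \<Longrightarrow> x s \<le> y s + e"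
  shows "gcm S x t \<le> gcm S y t + e"
proof -
  have "gcm S x t - e \<le> gcm S y t"
  proof (rule gcm_greatest[OF S])
    fix s u assume su: "(s, u) \<in> chord_pairs S t"
    have "gcm S x t \<le> chord x t s u"
      using m su by (intro gcm_lower[OF S, of m] chord_ge) (auto simp: chord_pairs_def)
    also have "\<dots> \<le> chord (\<lambda>r. y r + e) t s u"
      using su xy by (intro chord_mono) (auto simp: chord_pairs_def)
    also have "\<dots> = chord y t s u + e"
      using su by (intro chord_shift) (auto simp: chord_pairs_def)
    finally show "gcm S x t - e \<le> chord y t s u" by simp
  qed
  then show ?thesis by simp
qed

lemma gcm_dist_le:
  assumes S: "is_interval S" "t \<in> interior S"
    and m: "\<And>s. s \<in> S \<Longrightarrow> m \<le> x s" and xy: "\<And>s. s \<in> S \<Longrightarrow> \<bar>x s - y s\<bar> \<le> e"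
  shows "\<bar>gcm S x t - gcm S y t\<bar> \<le> e"
proof -
  have "gcm S x t \<le> gcm S y t + e"
    using xy by (intro gcm_le_gcm_add[OF S m]) (auto simp: abs_le_iff algebra_simps)
  \<comment> \<open>Here \<open>y\<close> inherits the lower bound \<open>m - e\<close> from
    \<open>x\<close>.\<close>
  moreover have "gcm S y t \<le> gcm S x t + e"
    using xy m by (intro gcm_le_gcm_add[OF S, of "m - e"]) (smt (verit))+
  ultimately show ?thesis by linarith
qed

section \<open>Measurability of infima over intervals\<close>

lemma cadlag_right: "x \<in> cadlag S \<Longrightarrow> s \<in> S \<Longrightarrow> (x \<longlongrightarrow> x s) (at s within S \<inter> {s<..})"
  by (simp add: cadlag_def)

text \<open>The right endpoint has to be included because right continuity says nothing there.\<close>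

lemma interval_right_dense:
  fixes S :: "real set"
  assumes S: "is_interval S"
  obtains C where "C \<subseteq> S" "countable C"
    "\<And>s. s \<in> S \<Longrightarrow> \<exists>q. (\<forall>k. q k \<in> C \<and> s \<le> q k) \<and> q \<longlonglongrightarrow> s"
proof
  \<comment> \<open>If \<open>S\<close> is unbounded above, \<open>Sup S\<close> is an unspecified
    real; intersecting with \<open>S\<close> makes that harmless.\<close>
  let ?C = "S \<inter> (\<rat> \<union> {Sup S})"
  show "?C \<subseteq> S" by auto
  show "countable ?C" by (intro countable_Int2) (simp add: countable_rat)
  fix s assume s: "s \<in> S"
  show "\<exists>q. (\<forall>k. q k \<in> ?C \<and> s \<le> q k) \<and> q \<longlonglongrightarrow> s"
  proof (cases "\<exists>u\<in>S. s < u")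
    case True
    then obtain u where u: "u \<in> S" "s < u" by auto
    have "\<exists>r\<in>\<rat>. s < r \<and> r < min u (s + 1 / Suc k)" for k :: nat
      using u Rats_dense_in_real[of s "min u (s + 1 / Suc k)"] by auto
    then obtain q where q: "\<And>k::nat. q k \<in> \<rat>" "\<And>k. s < q k" "\<And>k. q k < u" "\<And>k. q k < s + 1 / Suc k"
      by (metis min_less_iff_conj)
    have "q k \<in> S" for k
      using S s u q(2,3)[of k] unfolding is_interval_1 by (meson less_imp_le)
    moreover have "q \<longlonglongrightarrow> s"
    proof (rule tendsto_sandwich[OF _ _ tendsto_const])
      show "(\<lambda>k. s + 1 / Suc k) \<longlonglongrightarrow> s"
        using tendsto_add[OF tendsto_const LIMSEQ_inverse_real_of_nat, of s]
        by (simp add: inverse_eq_divide)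
    qed (use q(2,4) in \<open>auto intro!: always_eventually less_imp_le\<close>)
    ultimately show ?thesis using q by (intro exI[of _ q]) (auto intro: less_imp_le)
  next
    case False
    then have "Sup S = s" using s by (intro cSup_eq_maximum) force+
    then show ?thesis using s by (intro exI[of _ "\<lambda>_. s"]) auto
  qed
qed

text \<open>The filter omits \<open>s\<close> itself, but \<open>q\<close> may take that value; the
  distance is zero there.\<close>

lemma tendsto_right_sequence:
  fixes x :: "real \<Rightarrow> real"
  assumes "(x \<longlongrightarrow> x s) (at s within S \<inter> {s<..})" "\<And>k. q k \<in> S" "\<And>k. s \<le> q k" "q \<longlonglongrightarrow> s"
  shows "(\<lambda>k. x (q k)) \<longlonglongrightarrow> x s"
proof (rule metric_LIMSEQ_I)
  fix e :: real assume "0 < e"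
  then obtain r where r: "0 < r" "\<And>u. u \<in> S \<Longrightarrow> s < u \<Longrightarrow> dist u s < r \<Longrightarrow> dist (x u) (x s) < e"
    using assms(1) unfolding Lim_within by (auto simp: Ball_def)
  obtain m where m: "\<And>k. m \<le> k \<Longrightarrow> dist (q k) s < r"
    using metric_LIMSEQ_D[OF assms(4) r(1)] by auto
  have "dist (x (q k)) (x s) < e" if "m \<le> k" for k
    using r(2)[of "q k"] m[OF that] assms(2,3)[of k] \<open>0 < e\<close> by (cases "q k = s") auto
  then show "\<exists>no. \<forall>n\<ge>no. dist (x (q n)) (x s) < e" by blast
qed

lemma measurable_INF_right_continuous:
  fixes h :: "'a \<Rightarrow> real \<Rightarrow> real"
  assumes S: "is_interval S"
    and rc: "\<And>\<omega> s. \<omega> \<in> space M \<Longrightarrow> s \<in> S \<Longrightarrow> (h \<omega> \<longlongrightarrow> h \<omega> s) (at s within S \<inter> {s<..})"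
    and meas: "\<And>s. s \<in> S \<Longrightarrow> (\<lambda>\<omega>. h \<omega> s) \<in> borel_measurable M"
  shows "(\<lambda>\<omega>. INF s\<in>S. ereal (h \<omega> s)) \<in> borel_measurable M"
proof -
  obtain C where C: "C \<subseteq> S" "countable C"
    "\<And>s. s \<in> S \<Longrightarrow> \<exists>q. (\<forall>k. q k \<in> C \<and> s \<le> q k) \<and> q \<longlonglongrightarrow> s"
    using interval_right_dense[OF S] by metis
  have "(INF s\<in>S. ereal (h \<omega> s)) = (INF s\<in>C. ereal (h \<omega> s))" if \<omega>: "\<omega> \<in> space M" for \<omega>
  proof (rule antisym)
    show "(INF s\<in>S. ereal (h \<omega> s)) \<le> (INF s\<in>C. ereal (h \<omega> s))"
      using C(1) by (intro INF_superset_mono) auto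
    show "(INF s\<in>C. ereal (h \<omega> s)) \<le> (INF s\<in>S. ereal (h \<omega> s))"
    proof (rule INF_greatest)
      fix s assume s: "s \<in> S"
      then obtain q where q: "\<And>k. q k \<in> C" "\<And>k. s \<le> q k" "q \<longlonglongrightarrow> s" using C(3) by blast
      have "(\<lambda>k. ereal (h \<omega> (q k))) \<longlonglongrightarrow> ereal (h \<omega> s)"
        using q C(1) by (intro tendsto_ereal tendsto_right_sequence[OF rc[OF \<omega> s]]) auto
      then show "(INF s\<in>C. ereal (h \<omega> s)) \<le> ereal (h \<omega> s)"
        by (rule LIMSEQ_le_const) (use q in \<open>auto intro!: INF_lower\<close>)
    qed
  qed
  then show ?thesis
    using C(1) meas by (subst measurable_cong)
      (auto intro!: borel_measurable_INF[OF C(2)] borel_measurable_ereal)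
qed

lemma measurable_SUP_right_continuous:
  fixes h :: "'a \<Rightarrow> real \<Rightarrow> real"
  assumes S: "is_interval S"
    and rc: "\<And>\<omega> s. \<omega> \<in> space M \<Longrightarrow> s \<in> S \<Longrightarrow> (h \<omega> \<longlongrightarrow> h \<omega> s) (at s within S \<inter> {s<..})"
    and meas: "\<And>s. s \<in> S \<Longrightarrow> (\<lambda>\<omega>. h \<omega> s) \<in> borel_measurable M"
  shows "(\<lambda>\<omega>. SUP s\<in>S. ereal (h \<omega> s)) \<in> borel_measurable M"
proof -
  have "(\<lambda>\<omega>. - (INF s\<in>S. ereal (- h \<omega> s))) \<in> borel_measurable M"
    using assms by (intro borel_measurable_uminus_ereal measurable_INF_right_continuous
        tendsto_minus borel_measurable_uminus) auto
  moreover have "- (INF s\<in>S. ereal (- h \<omega> s)) = (SUP s\<in>S. ereal (h \<omega> s))" for \<omega>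
    using ereal_INF_uminus_eq[of "\<lambda>s. ereal (h \<omega> s)" S] by simp
  ultimately show ?thesis by simp
qed

lemma measurable_lower_hull:
  assumes S: "is_interval S"
    and rc: "\<And>\<omega> s. \<omega> \<in> space M \<Longrightarrow> s \<in> S \<Longrightarrow> (x \<omega> \<longlongrightarrow> x \<omega> s) (at s within S \<inter> {s<..})"
    and meas: "\<And>s. s \<in> S \<Longrightarrow> (\<lambda>\<omega>. x \<omega> s) \<in> borel_measurable M"
  shows "(\<lambda>\<omega>. lower_hull S (x \<omega>) t) \<in> borel_measurable M"
proof -
  \<comment> \<open>Separate right-dense sets on the two sides of \<open>t\<close>: approximating a
    left end from the right then cannot carry it past \<open>t\<close>.\<close>
  have "is_interval (S \<inter> {..t})" "is_interval (S \<inter> {t..})"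
    using S by (simp_all add: is_interval_Int is_interval_ic is_interval_ci)
  then obtain C D where
    C: "C \<subseteq> S \<inter> {..t}" "countable C"
      "\<And>s. s \<in> S \<inter> {..t} \<Longrightarrow> \<exists>q. (\<forall>k. q k \<in> C \<and> s \<le> q k) \<and> q \<longlonglongrightarrow> s" and
    D: "D \<subseteq> S \<inter> {t..}" "countable D"
      "\<And>s. s \<in> S \<inter> {t..} \<Longrightarrow> \<exists>q. (\<forall>k. q k \<in> D \<and> s \<le> q k) \<and> q \<longlonglongrightarrow> s"
    using interval_right_dense by metis
  define P where "P = {(s, u) \<in> C \<times> D. s < u}"
  have P: "P \<subseteq> chord_pairs S t" using C(1) D(1) by (auto simp: P_def chord_pairs_def)
  have cP: "countable P"
    unfolding P_def using C(2) D(2) by (rule countable_subset[rotated, OF countable_SIGMA]) auto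
  have eq: "lower_hull S (x \<omega>) t = (INF (s, u)\<in>P. ereal (chord (x \<omega>) t s u))"
    (is "_ = ?R") if \<omega>: "\<omega> \<in> space M" for \<omega>
  proof (rule antisym)
    show "lower_hull S (x \<omega>) t \<le> ?R"
      unfolding lower_hull_def using P by (intro INF_superset_mono) auto
    show "?R \<le> lower_hull S (x \<omega>) t"
    proof (rule lower_hull_greatest)
      fix s u assume su: "(s, u) \<in> chord_pairs S t"
      then have su': "s \<in> S" "u \<in> S" "s \<le> t" "t \<le> u" "s < u" by (auto simp: chord_pairs_def)
      obtain q where q: "\<And>k. q k \<in> C" "\<And>k. s \<le> q k" "q \<longlonglongrightarrow> s" using C(3)[of s] su' by auto
      obtain r where r: "\<And>k. r k \<in> D" "\<And>k. u \<le> r k" "r \<longlonglongrightarrow> u" using D(3)[of u] su' by auto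
      have "(\<lambda>k. x \<omega> (q k)) \<longlonglongrightarrow> x \<omega> s" "(\<lambda>k. x \<omega> (r k)) \<longlonglongrightarrow> x \<omega> u"
        using q r C(1) D(1) su' by (auto intro!: tendsto_right_sequence[OF rc[OF \<omega>]])
      then have "(\<lambda>k. chord (x \<omega>) t (q k) (r k)) \<longlonglongrightarrow> chord (x \<omega>) t s u"
        unfolding chord_def using su' q r by (intro tendsto_intros) auto
      then have lim: "(\<lambda>k. ereal (chord (x \<omega>) t (q k) (r k))) \<longlonglongrightarrow> ereal (chord (x \<omega>) t s u)"
        by (rule tendsto_ereal)
      \<comment> \<open>A pair belongs to \<open>P\<close> only if \<open>q k < r k\<close>; for
        early \<open>k\<close> both may equal \<open>t\<close>.\<close>
      have "(\<lambda>k. r k - q k) \<longlonglongrightarrow> u - s" using q r by (intro tendsto_intros)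
      then have "\<forall>\<^sub>F k in sequentially. 0 < r k - q k"
        using su' by (intro order_tendstoD) auto
      then have "\<forall>\<^sub>F k in sequentially. ?R \<le> ereal (chord (x \<omega>) t (q k) (r k))"
        by eventually_elim (use q r in \<open>auto simp: P_def intro!: INF_lower2[of "(q _, r _)"]\<close>)
      then show "?R \<le> ereal (chord (x \<omega>) t s u)"
        using tendsto_lowerbound[OF lim] by simp
    qed
  qed
  have "(\<lambda>\<omega>. INF (s, u)\<in>P. ereal (chord (x \<omega>) t s u)) \<in> borel_measurable M"
  proof (intro borel_measurable_INF cP)
    fix su assume "su \<in> P"
    then show "(\<lambda>\<omega>. case su of (s, u) \<Rightarrow> ereal (chord (x \<omega>) t s u)) \<in> borel_measurable M"
      using P meas by (auto simp: chord_def chord_pairs_def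
          intro!: borel_measurable_ereal borel_measurable_divide borel_measurable_add borel_measurable_times)
  qed
  then show ?thesis by (subst measurable_cong[OF eq])
qed

lemma measurable_gcm:
  assumes S: "is_interval S" "t \<in> interior S"
    and rc: "\<And>\<omega> s. \<omega> \<in> space M \<Longrightarrow> s \<in> S \<Longrightarrow> (x \<omega> \<longlongrightarrow> x \<omega> s) (at s within S \<inter> {s<..})"
    and meas: "\<And>s. s \<in> S \<Longrightarrow> (\<lambda>\<omega>. x \<omega> s) \<in> borel_measurable M"
  shows "(\<lambda>\<omega>. gcm S (x \<omega>) t) \<in> borel_measurable M"
proof -
  have [measurable]: "(\<lambda>\<omega>. lower_hull S (x \<omega>) t) \<in> borel_measurable M"
    by (rule measurable_lower_hull[OF S(1) rc meas])
  show ?thesis unfolding gcm_eq_lower_hull[OF S] by measurable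
qed

section \<open>The ball \<open>\<sigma>\<close>-algebra\<close>

abbreviation D_sigma :: "(real \<Rightarrow> real) measure" where
  "D_sigma \<equiv> ball_sigma (cadlag UNIV) loc_unif_dist"

lemma space_D_sigma [simp]: "space D_sigma = cadlag UNIV"
  unfolding ball_sigma_def by (intro space_measure_of) (auto simp: D.mball_def)

lemma mball_in_D_sigma: "z \<in> cadlag UNIV \<Longrightarrow> D.mball z r \<in> sets D_sigma"
  unfolding ball_sigma_def by (subst sets_measure_of) auto

lemma measurable_loc_unif_dist:
  assumes "z \<in> cadlag UNIV"
  shows "loc_unif_dist z \<in> borel_measurable D_sigma"
  unfolding borel_measurable_iff_less
proof
  fix a
  have "{w \<in> space D_sigma. loc_unif_dist z w < a} = D.mball z a"
    using assms by (auto simp: D.mball_def)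
  then show "{w \<in> space D_sigma. loc_unif_dist z w < a} \<in> sets D_sigma"
    using mball_in_D_sigma[OF assms] by simp
qed

text \<open>Supplies the step-shaped ball centres used below. The second branch takes over at
  \<open>a\<close> itself, as right continuity demands.\<close>

lemma cadlag_If:
  assumes "x \<in> cadlag UNIV" "y \<in> cadlag UNIV"
  shows "(\<lambda>s. if s < a then x s else y s) \<in> cadlag UNIV" (is "?z \<in> _")
proof -
  have r: "(?z \<longlongrightarrow> ?z t) (at_right t)" for t
  proof (cases "t < a")
    case True
    then have "\<forall>\<^sub>F s in at_right t. ?z s = x s"
      by (auto simp: eventually_at_right_field intro!: exI[of _ a])
    then show ?thesis using assms(1) True by (simp add: cadlag_def filterlim_cong)
  next
    case False
    then have "\<forall>\<^sub>F s in at_right t. ?z s = y s"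
      by (auto simp: eventually_at_right_field intro!: exI[of _ "t + 1"])
    then show ?thesis using assms(2) False by (simp add: cadlag_def filterlim_cong)
  qed
  have l: "\<exists>l. (?z \<longlongrightarrow> l) (at_left t)" for t
  proof (cases "t \<le> a")
    case True
    then have "\<forall>\<^sub>F s in at_left t. ?z s = x s"
      by (auto simp: eventually_at_left_field intro!: exI[of _ "t - 1"])
    then show ?thesis using assms(1) by (simp add: cadlag_def filterlim_cong)
  next
    case False
    then have "\<forall>\<^sub>F s in at_left t. ?z s = y s"
      by (auto simp: eventually_at_left_field intro!: exI[of _ a])
    then show ?thesis using assms(2) by (simp add: cadlag_def filterlim_cong)
  qed
  show ?thesis using r l by (simp add: cadlag_def)
qed

lemma cadlag_continuous: "continuous_on UNIV x \<Longrightarrow> x \<in> cadlag UNIV"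
  unfolding cadlag_def continuous_on_def using tendsto_within_subset by blast

lemma cadlag_add: "x \<in> cadlag S \<Longrightarrow> y \<in> cadlag S \<Longrightarrow> (\<lambda>s. x s + y s) \<in> cadlag S"
  unfolding cadlag_def by (auto intro!: tendsto_add) (metis tendsto_add)

definition frac_dist :: "nat \<Rightarrow> (real \<Rightarrow> real) \<Rightarrow> (real \<Rightarrow> real) \<Rightarrow> real" where
  "frac_dist k x y = unif_dist (Suc k) x y / (1 + unif_dist (Suc k) x y)"

lemma frac_dist_bounds:
  assumes "x \<in> cadlag UNIV" "y \<in> cadlag UNIV"
  shows "0 \<le> frac_dist k x y" "frac_dist k x y \<le> 1"
  using unif_dist_nonneg[OF assms, of "Suc k"] by (auto simp: frac_dist_def)

lemma loc_unif_dist_frac: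
  "x \<in> cadlag UNIV \<Longrightarrow> y \<in> cadlag UNIV \<Longrightarrow> loc_unif_dist x y = (\<Sum>k. (1/2) ^ Suc k * frac_dist k x y)"
  by (simp add: loc_unif_dist_def frac_dist_def)

lemma summable_frac_dist:
  "x \<in> cadlag UNIV \<Longrightarrow> y \<in> cadlag UNIV \<Longrightarrow> summable (\<lambda>k. (1/2) ^ Suc k * frac_dist k x y)"
  using summable_loc_unif_dist by (simp add: frac_dist_def)

text \<open>
  Letting the centre of the ball tend to infinity beyond \<open>k\<close> saturates all terms of the
  metric of index at least \<open>k\<close>, so the partial sums of the metric are limits of distances.
\<close>

lemma measurable_frac_dist_sum:
  assumes z: "z \<in> cadlag UNIV"
  shows "(\<lambda>y. \<Sum>j<k. (1/2) ^ Suc j * frac_dist j z y) \<in> borel_measurable D_sigma"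
proof -
  \<comment> \<open>The cut at \<open>k + 1/2\<close> leaves \<open>[-k, k]\<close> alone, hence all
    terms of index below \<open>k\<close>, while the point \<open>k + 1\<close> lies in the interval
    of every later term.\<close>
  define zm where "zm m s = (if s < real k + 1/2 then z s else real m)" for m s
  have zm: "zm m \<in> cadlag UNIV" for m
    unfolding zm_def[abs_def] by (intro cadlag_If z cadlag_continuous continuous_intros)
  \<comment> \<open>The offset \<open>(1/2) ^ k\<close> is the total weight of the saturated
    terms.\<close>
  have "(\<lambda>y. (\<Sum>j<k. (1/2) ^ Suc j * frac_dist j z y) + (1/2) ^ k) \<in> borel_measurable D_sigma"
  proof (rule borel_measurable_LIMSEQ_real)
    show "loc_unif_dist (zm m) \<in> borel_measurable D_sigma" for m
      by (rule measurable_loc_unif_dist[OF zm])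
    fix y assume "y \<in> space D_sigma"
    then have y: "y \<in> cadlag UNIV" by simp
    let ?S = "\<Sum>j<k. (1/2) ^ Suc j * frac_dist j z y"
    let ?t = "\<lambda>m j. (1/2) ^ Suc (j + k) * frac_dist (j + k) (zm m) y"
    have geo: "summable (\<lambda>j. (1/2::real) ^ Suc (j + k) * c)" "(\<Sum>j. (1/2::real) ^ Suc (j + k) * c) = (1/2) ^ k * c" for c
    proof -
      have "(\<lambda>j. (1/2::real) ^ Suc j * ((1/2) ^ k * c)) sums (1 * ((1/2) ^ k * c))"
        by (intro sums_mult2 power_half_series)
      then have "(\<lambda>j. (1/2::real) ^ Suc (j + k) * c) sums ((1/2) ^ k * c)"
        by (simp add: power_add mult_ac)
      then show "summable (\<lambda>j. (1/2::real) ^ Suc (j + k) * c)"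
        "(\<Sum>j. (1/2::real) ^ Suc (j + k) * c) = (1/2) ^ k * c"
        by (simp_all add: sums_iff)
    qed
    have st: "summable (?t m)" for m
      using summable_ignore_initial_segment[OF summable_frac_dist[OF zm y], of k m] by simp
    have "unif_dist (Suc j) (zm m) y = unif_dist (Suc j) z y" if "j < k" for j m
      unfolding unif_dist_def using that by (intro SUP_cong refl) (auto simp: zm_def)
    then have "(\<Sum>j<k. (1/2) ^ Suc j * frac_dist j (zm m) y) = ?S" for m
      by (simp add: frac_dist_def)
    then have split: "loc_unif_dist (zm m) y = ?S + suminf (?t m)" for m
      using suminf_split_initial_segment[OF summable_frac_dist[OF zm y], of m k]
      by (simp add: loc_unif_dist_frac[OF zm y])
    define c where "c m = \<bar>real m - y (real k + 1)\<bar>" for m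
    have low: "c m / (1 + c m) \<le> frac_dist (j + k) (zm m) y" for m j
    proof -
      have "c m \<le> unif_dist (Suc (j + k)) (zm m) y"
        using unif_dist_upper[OF zm y, of "real k + 1" "Suc (j + k)" m] by (simp add: c_def zm_def)
      moreover have "0 \<le> c m" by (simp add: c_def)
      ultimately show ?thesis by (simp add: frac_dist_def divide_simps) (simp add: algebra_simps)
    qed
    have "filterlim (\<lambda>m. real m - y (real k + 1)) at_top sequentially" by real_asymp
    then have "filterlim c at_top sequentially"
      unfolding c_def[abs_def] by (rule filterlim_at_top_mono) (auto intro!: always_eventually)
    moreover have "((\<lambda>r::real. r / (1 + r)) \<longlongrightarrow> 1) at_top" by real_asymp
    ultimately have lim: "(\<lambda>m. ?S + (1/2) ^ k * (c m / (1 + c m))) \<longlonglongrightarrow> ?S + (1/2) ^ k * 1"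
      by (intro tendsto_intros) (rule filterlim_compose)
    show "(\<lambda>m. loc_unif_dist (zm m) y) \<longlonglongrightarrow> ?S + (1/2) ^ k"
    proof (rule tendsto_sandwich[OF _ _ _ tendsto_const])
      show "(\<lambda>m. ?S + (1/2) ^ k * (c m / (1 + c m))) \<longlonglongrightarrow> ?S + (1/2) ^ k" using lim by simp
      have "(1/2) ^ k * (c m / (1 + c m)) \<le> suminf (?t m)" for m
        unfolding geo(2)[symmetric] by (intro suminf_le mult_left_mono low geo st) auto
      then show "\<forall>\<^sub>F m in sequentially. ?S + (1/2) ^ k * (c m / (1 + c m)) \<le> loc_unif_dist (zm m) y"
        by (simp add: split)
      have "suminf (?t m) \<le> (1/2) ^ k * 1" for m
        unfolding geo(2)[symmetric] by (intro suminf_le mult_left_mono frac_dist_bounds zm y geo st) auto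
      then show "\<forall>\<^sub>F m in sequentially. loc_unif_dist (zm m) y \<le> ?S + (1/2) ^ k"
        by (simp add: split)
    qed
  qed
  from borel_measurable_diff[OF this borel_measurable_const[of "(1/2) ^ k"]]
  show ?thesis by simp
qed

text \<open>Consecutive partial sums differ by one weighted term, and \<open>f / (1 - f)\<close>
  inverts \<open>r / (1 + r)\<close>.\<close>

lemma measurable_unif_dist:
  assumes z: "z \<in> cadlag UNIV"
  shows "unif_dist (Suc k) z \<in> borel_measurable D_sigma"
proof -
  let ?S = "\<lambda>k y. \<Sum>j<k. (1/2) ^ Suc j * frac_dist j z y"
  note measurable_frac_dist_sum[OF z, measurable]
  define f where "f y = 2 ^ Suc k * (?S (Suc k) y - ?S k y)" for y
  have [measurable]: "f \<in> borel_measurable D_sigma" unfolding f_def[abs_def] by measurable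
  have f: "f y = frac_dist k z y" for y by (simp add: f_def power_one_over field_simps)
  have "unif_dist (Suc k) z y = f y / (1 - f y)" if "y \<in> space D_sigma" for y
    using unif_dist_nonneg[OF z, of y "Suc k"] that unfolding f frac_dist_def
    by (simp add: divide_simps)
  then show ?thesis by (subst measurable_cong) measurable
qed

text \<open>
  A spike of height \<open>m\<close> over \<open>[t, t + 1/m)\<close> has distance asymptotically \<open>m - y t\<close> from \<open>y\<close>.
\<close>

lemma measurable_coordinate: "(\<lambda>y. y t) \<in> borel_measurable D_sigma"
proof -
  obtain k :: nat where k: "\<bar>t\<bar> \<le> real k" using real_arch_simple by blast
  define z where "z m s = (if s < t then 0 else if s < t + 1 / real m then real m else 0)" for m s
  have z: "z m \<in> cadlag UNIV" for m
    unfolding z_def[abs_def] by (intro cadlag_If cadlag_continuous continuous_intros)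
  show ?thesis
  proof (rule borel_measurable_LIMSEQ_real)
    show "(\<lambda>y. real m - unif_dist (Suc k) (z m) y) \<in> borel_measurable D_sigma" for m
      using measurable_unif_dist[OF z] by measurable
    fix y assume "y \<in> space D_sigma"
    then have y: "y \<in> cadlag UNIV" by simp
    obtain B where B: "\<And>s. \<bar>s\<bar> \<le> real (Suc k) \<Longrightarrow> \<bar>y s\<bar> \<le> B"
      using cadlag_bounded[OF y, of "- real (Suc k)" "real (Suc k)"] by (metis abs_le_iff atLeastAtMost_iff minus_le_iff)
    show "(\<lambda>m. real m - unif_dist (Suc k) (z m) y) \<longlonglongrightarrow> y t"
    proof (rule LIMSEQ_I)
      fix e :: real assume e: "0 < e"
      have "(y \<longlongrightarrow> y t) (at_right t)" using y by (simp add: cadlag_def)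
      from tendstoD[OF this, of "e/2"] e
      obtain b where b: "t < b" "\<And>s. t < s \<Longrightarrow> s < b \<Longrightarrow> \<bar>y s - y t\<bar> < e / 2"
        by (auto simp: eventually_at_right_field dist_real_def)
      have "((\<lambda>m. t + 1 / real m) \<longlongrightarrow> t) sequentially" by real_asymp
      from order_tendstoD(2)[OF this b(1)]
      have "\<forall>\<^sub>F m in sequentially. t + 1 / real m < b" .
      \<comment> \<open>Off the spike the difference is at most \<open>B\<close>, and
        \<open>2 * B \<le> m\<close> gives \<open>B \<le> m - y t\<close>, so those points do not
        exceed the value at \<open>t\<close>.\<close>
      moreover have "\<forall>\<^sub>F m in sequentially. 2 * B \<le> real m"
        using filterlim_real_sequentially by (auto simp: filterlim_at_top)
      moreover have "\<forall>\<^sub>F m in sequentially. 0 < (m::nat)" by (rule eventually_gt_at_top)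
      ultimately have "\<forall>\<^sub>F m in sequentially. \<bar>real m - unif_dist (Suc k) (z m) y - y t\<bar> < e"
      proof eventually_elim
        case (elim m)
        have yt: "\<bar>y t\<bar> \<le> B" using B[of t] k by auto
        have "\<bar>z m t - y t\<bar> \<le> unif_dist (Suc k) (z m) y"
          using k by (intro unif_dist_upper z y) auto
        then have "real m - y t \<le> unif_dist (Suc k) (z m) y" using elim by (simp add: z_def)
        moreover have "unif_dist (Suc k) (z m) y \<le> real m - y t + e / 2"
          unfolding unif_dist_def
        proof (rule cSUP_least)
          fix s assume "s \<in> {- real (Suc k)..real (Suc k)}"
          then have ys: "\<bar>y s\<bar> \<le> B" by (intro B) auto
          have "y t - e / 2 < y s" if "t < s" "s < b" using b(2)[OF that] by linarith
          then show "\<bar>z m s - y s\<bar> \<le> real m - y t + e / 2"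
            using ys yt elim e by (cases "s = t") (auto simp: z_def)
        qed simp
        ultimately show ?case using e by linarith
      qed
      then show "\<exists>no. \<forall>m\<ge>no. norm (real m - unif_dist (Suc k) (z m) y - y t) < e"
        by (simp add: eventually_sequentially)
    qed
  qed
qed

text \<open>A single term of the series bounds \<open>loc_unif_dist\<close> from below, so closeness
  in the metric forces uniform closeness on the corresponding window.\<close>

lemma continuous_map_unif_dist_Lipschitz:
  assumes "\<And>z w. z \<in> cadlag UNIV \<Longrightarrow> w \<in> cadlag UNIV \<Longrightarrow> \<bar>F z - F w\<bar> \<le> L * unif_dist (Suc k) z w"
  shows "continuous_map D.mtopology euclideanreal F"
  unfolding D.continuous_map_from_metric
proof (intro conjI ballI allI impI)
  show "F \<in> cadlag UNIV \<rightarrow> topspace euclideanreal" by simp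
  fix z U assume z: "z \<in> cadlag UNIV" and "openin euclideanreal U \<and> F z \<in> U"
  then obtain e where e: "0 < e" "\<And>r. \<bar>r - F z\<bar> < e \<Longrightarrow> r \<in> U"
    by (auto simp: open_dist dist_real_def)
  \<comment> \<open>\<open>L\<close> may be zero or negative, but \<open>\<eta>\<close> needs a
    positive divisor.\<close>
  define L' where "L' = max L 1"
  define \<eta> where "\<eta> = e / L'"
  have L': "L \<le> L'" "0 < L'" by (auto simp: L'_def)
  have \<eta>: "0 < \<eta>" using e L' by (simp add: \<eta>_def)
  define r where "r = (1/2) ^ Suc k * (\<eta> / (1 + \<eta>))"
  have "F w \<in> U" if w: "w \<in> cadlag UNIV" "loc_unif_dist z w < r" for w
  proof -
    have "(1/2) ^ Suc k * frac_dist k z w = (\<Sum>j\<in>{k}. (1/2) ^ Suc j * frac_dist j z w)" by simp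
    also have "\<dots> \<le> loc_unif_dist z w"
      unfolding loc_unif_dist_frac[OF z w(1)]
      by (intro sum_le_suminf summable_frac_dist z w(1)) (auto intro!: mult_nonneg_nonneg frac_dist_bounds z w)
    finally have "(1/2) ^ Suc k * frac_dist k z w < (1/2) ^ Suc k * (\<eta> / (1 + \<eta>))"
      using w(2) unfolding r_def by (rule le_less_trans)
    then have "frac_dist k z w < \<eta> / (1 + \<eta>)" by (rule mult_left_less_imp_less) simp
    then have "unif_dist (Suc k) z w < \<eta>"
      using \<eta> unif_dist_nonneg[OF z w(1), of "Suc k"] by (simp add: frac_dist_def divide_simps split: if_splits) (simp add: algebra_simps)
    then have "L' * unif_dist (Suc k) z w < e" using L' by (simp add: \<eta>_def field_simps)
    moreover have "L * unif_dist (Suc k) z w \<le> L' * unif_dist (Suc k) z w"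
      by (intro mult_right_mono L' unif_dist_nonneg z w(1))
    ultimately show ?thesis using assms[OF z w(1)] by (intro e(2)) auto
  qed
  moreover have "0 < r" using \<eta> by (simp add: r_def)
  ultimately show "\<exists>r>0. \<forall>w. w \<in> cadlag UNIV \<and> loc_unif_dist z w < r \<longrightarrow> F w \<in> U" by blast
qed

lemma zero_in_interior_interval: "0 < c \<Longrightarrow> (0::real) \<in> interior {- c..c}"
  by (simp add: interior_atLeastAtMost_real)

text \<open>Cadlag functions are bounded on a compact window; this is the lower bound that
  \<open>gcm_dist_le\<close> asks for.\<close>

lemma gcm_interval_Lipschitz:
  assumes b: "b \<in> cadlag UNIV" and z: "z \<in> cadlag UNIV" and w: "w \<in> cadlag UNIV" and k: "0 < k"
  shows "\<bar>gcm {- real k..real k} (\<lambda>s. b s + z s) 0 - gcm {- real k..real k} (\<lambda>s. b s + w s) 0\<bar>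
    \<le> unif_dist k z w"
proof -
  obtain B where B: "\<forall>s\<in>{- real k..real k}. \<bar>b s + z s\<bar> \<le> B"
    using cadlag_bounded[OF cadlag_add[OF b z]] by blast
  show ?thesis
  proof (rule gcm_dist_le[of _ _ "- B"])
    show "0 \<in> interior {- real k..real k}" using k by (intro zero_in_interior_interval) simp
    show "- B \<le> b s + z s" if "s \<in> {- real k..real k}" for s using B that by force
    show "\<bar>b s + z s - (b s + w s)\<bar> \<le> unif_dist k z w" if "s \<in> {- real k..real k}" for s
      using unif_dist_upper[OF z w, of s k] that by auto
  qed (simp add: is_interval_cc)
qed

lemma measurable_gcm_D:
  assumes S: "is_interval S" "0 \<in> interior S" and b: "b \<in> cadlag UNIV"
  shows "(\<lambda>z. gcm S (\<lambda>s. b s + z s) 0) \<in> borel_measurable D_sigma"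
proof (rule measurable_gcm[OF S])
  fix z s assume "z \<in> space D_sigma"
  then have "(\<lambda>s. b s + z s) \<in> cadlag UNIV" using b by (simp add: cadlag_add)
  from cadlag_right[OF this] show "((\<lambda>s. b s + z s) \<longlongrightarrow> b s + z s) (at s within S \<inter> {s<..})"
    by (rule tendsto_within_subset) auto
next
  show "(\<lambda>z. b s + z s) \<in> borel_measurable D_sigma" for s
    using measurable_coordinate by measurable
qed

section \<open>Localization\<close>

text \<open>Reflection at 0 reduces a far left end to a far right end.\<close>

lemma chord_reflect: "chord (\<lambda>r. x (- r)) 0 (- u) (- s) = chord x 0 s u"
  by (simp add: chord_def add.commute)

text \<open>
  Up to the weight \<open>u\<bar>s\<bar> / (u + \<bar>s\<bar>)\<close>, which hardly depends on \<open>u\<close> once \<open>u\<close> is large compared to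
  \<open>\<bar>s\<bar>\<close>, a chord at 0 is the sum of the slopes \<open>y u / u\<close> and \<open>y s / \<bar>s\<bar>\<close>.
\<close>

lemma chord_far_ge:
  assumes s: "s < 0" "- \<tau> \<le> s" and u: "0 < T" "T \<le> u'" "u' \<le> u"
    and K: "0 \<le> K" "- K \<le> y s" "0 \<le> y u" and e: "0 \<le> e" "y u' / u' \<le> y u / u + e"
    and H: "H \<le> chord y 0 s u'" "H \<le> 0"
  shows "H - (\<tau> * e + K * \<tau> / (T + \<tau>)) \<le> chord y 0 s u"
proof -
  \<comment> \<open>The chord ending at \<open>u\<close> is \<open>w * B\<close>, and
    \<open>w'\<close> is the weight for the nearer end \<open>u'\<close>. Since
    \<open>w \<le> - s \<le> \<tau>\<close> and \<open>T \<le> u'\<close>, moving to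
    \<open>u'\<close> keeps at least the fraction \<open>r\<close> of the weight.\<close>
  define B where "B = y u / u + y s / (- s)"
  define w where "w = u * (- s) / (u - s)"
  define w' where "w' = u' * (- s) / (u' - s)"
  define r where "r = T / (T + \<tau>)"
  have pos: "0 < u" "0 < u'" "0 < \<tau>" "0 < u - s" "0 < u' - s" using s u by auto
  have V: "chord y 0 s u = w * B"
    unfolding B_def w_def chord_def using pos s by (simp add: field_simps)
  have "chord y 0 s u' = w' * (y u' / u' + y s / (- s))"
    unfolding w'_def chord_def using pos s by (simp add: field_simps)
  moreover have w'0: "0 \<le> w'" unfolding w'_def using pos s by (intro divide_nonneg_pos mult_nonneg_nonneg) auto
  ultimately have V': "H \<le> w' * (B + e)"
    using H(1) mult_left_mono[OF e(2) w'0] by (simp add: B_def algebra_simps)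
  have w: "0 \<le> w" unfolding w_def using pos s by (intro divide_nonneg_pos mult_nonneg_nonneg) auto
  have "u * (- s) \<le> - s * (u - s)" using s by (simp add: algebra_simps)
  then have w2: "w \<le> - s" unfolding w_def using pos by (simp only: pos_divide_le_eq)
  have w\<tau>: "w * e \<le> \<tau> * e" using s e(1) w2 by (intro mult_right_mono) auto
  have r: "0 \<le> r" "r \<le> 1" "1 - r = \<tau> / (T + \<tau>)" using u pos by (auto simp: r_def field_simps)
  have "T * (- s) \<le> u' * \<tau>" using u s pos by (intro mult_mono) auto
  then have "T * (u' - s) \<le> u' * (T + \<tau>)" by (simp add: algebra_simps)
  then have "r \<le> u' / (u' - s)"
    using pos u unfolding r_def by (simp add: pos_divide_le_eq pos_le_divide_eq)
  then have "r * (- s) \<le> u' / (u' - s) * (- s)" using s by (intro mult_right_mono) auto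
  then have "r * (- s) \<le> w'" by (simp add: w'_def)
  then have w'r: "r * w \<le> w'" using mult_left_mono[OF w2 r(1)] by linarith
  show ?thesis
  \<comment> \<open>If \<open>B + e\<close> is nonnegative, the chord is at least
    \<open>- (\<tau> * e)\<close> and \<open>H \<le> 0\<close> suffices. If it is negative,
    \<open>r * w \<le> w'\<close> turns the bound on \<open>H\<close> into
    \<open>r * w * (B + e)\<close>; the remaining fraction \<open>1 - r\<close> of the chord costs
    at most \<open>(1 - r) * K\<close>.\<close>
  proof (cases "0 \<le> B + e")
    case True
    then have "0 \<le> w * (B + e)" using w by simp
    then have "- (\<tau> * e) \<le> chord y 0 s u" using w\<tau> by (simp add: V algebra_simps)
    moreover have "0 \<le> K * \<tau> / (T + \<tau>)" using K pos u by simp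
    ultimately show ?thesis using H(2) by linarith
  next
    case False
    then have "w' * (B + e) \<le> r * w * (B + e)" using w'r by (intro mult_right_mono_neg) auto
    also have "\<dots> = r * (chord y 0 s u + w * e)" by (simp add: V algebra_simps)
    also have "\<dots> \<le> r * (chord y 0 s u) + \<tau> * e"
    proof -
      have "r * (w * e) \<le> 1 * (w * e)" using r w e by (intro mult_right_mono) auto
      then show ?thesis using w\<tau> by (simp add: distrib_left)
    qed
    finally have "H \<le> r * chord y 0 s u + \<tau> * e" using V' by linarith
    moreover have "- K \<le> chord y 0 s u" using s pos K by (intro chord_ge) auto
    then have "(1 - r) * (- K) \<le> (1 - r) * chord y 0 s u" using r by (intro mult_left_mono) auto
    moreover have "(1 - r) * K = K * \<tau> / (T + \<tau>)" by (simp add: r(3))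
    ultimately show ?thesis by (simp add: algebra_simps)
  qed
qed

text \<open>The deterministic core: \<open>far\<close>, \<open>near\<close>, \<open>right\<close>
  and \<open>left\<close> are what A3, tightness and the two halves of A4 provide on a single good
  path.\<close>

lemma gcm_localization:
  assumes c: "{- c..c} \<subseteq> I" "\<tau> \<le> c" "T \<le> c" and \<tau>: "0 < \<tau>" "0 < T" "0 \<le> K" "0 \<le> e"
    and y0: "y 0 = 0"
    and far: "\<And>s. s \<in> I \<Longrightarrow> \<tau> \<le> \<bar>s\<bar> \<Longrightarrow> 0 \<le> y s" and near: "\<And>s. \<bar>s\<bar> \<le> \<tau> \<Longrightarrow> - K \<le> y s"
    and right: "\<And>u. u \<in> I \<Longrightarrow> T \<le> u \<Longrightarrow> \<exists>u'. T \<le> u' \<and> u' \<le> c \<and> y u' / u' \<le> y u / u + e"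
    and left: "\<And>s. s \<in> I \<Longrightarrow> s \<le> - T \<Longrightarrow> \<exists>s'. - c \<le> s' \<and> s' \<le> - T \<and> y s / s - e \<le> y s' / s'"
    and su: "(s, u) \<in> chord_pairs I 0"
  shows "gcm {- c..c} y 0 - (\<tau> * e + K * \<tau> / (T + \<tau>)) \<le> chord y 0 s u"
proof -
  let ?H = "gcm {- c..c} y 0" and ?E = "\<tau> * e + K * \<tau> / (T + \<tau>)"
  have su': "s \<in> I" "u \<in> I" "s \<le> 0" "0 \<le> u" "s < u" using su by (auto simp: chord_pairs_def)
  have E: "0 \<le> ?E" using \<tau> by simp
  have yK: "- K \<le> y r" if "r \<in> I" for r
    using near[of r] far[OF that] \<tau> by (cases "\<bar>r\<bar> \<le> \<tau>") auto
  have H: "?H \<le> chord y 0 s' u'" if "s' \<in> {- c..c}" "u' \<in> {- c..c}" "s' \<le> 0" "0 \<le> u'" "s' < u'" for s' u'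
    using that c(1) \<tau> c
    by (intro gcm_lower[of _ _ "- K"] is_interval_cc zero_in_interior_interval chord_ge yK)
       (auto simp: chord_pairs_def)
  \<comment> \<open>The chord over \<open>[0, c]\<close> has the value \<open>y 0 = 0\<close> at
    0.\<close>
  have H0: "?H \<le> 0" using H[of 0 c] \<tau> c by (simp add: chord_def y0)
  \<comment> \<open>If a chord leaves the window, one end is beyond \<open>c \<ge> \<tau>\<close>;
    the other is then either beyond \<open>\<tau>\<close> on its own side (case 3) or at distance at
    most \<open>\<tau>\<close> from 0 (cases 4 and 5).\<close>
  consider "s = 0 \<or> u = 0" | "- c \<le> s" "u \<le> c" "s < 0" "0 < u" | "s < - \<tau>" "\<tau> < u"
    | "- \<tau> \<le> s" "c < u" "s < 0" | "s < - c" "u \<le> \<tau>" "0 < u"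
    using su' c by linarith
  then show ?thesis
  proof cases
    case 1
    then have "chord y 0 s u = 0" using y0 su' by (auto simp: chord_def)
    then show ?thesis using H0 E by linarith
  next
    case 2
    then have "?H \<le> chord y 0 s u" by (intro H) auto
    then show ?thesis using E by linarith
  next
    case 3
    then have "0 \<le> chord y 0 s u" using su' by (intro chord_ge far) auto
    then show ?thesis using H0 E by linarith
  next
    case 4
    obtain u' where u': "T \<le> u'" "u' \<le> c" "y u' / u' \<le> y u / u + e"
      using right[of u] su' 4 c by auto
    show ?thesis
      using 4 u' \<tau> c su' H0 by (intro chord_far_ge[where u'=u'] H yK far) auto
  next
    case 5
    obtain s' where s': "- c \<le> s'" "s' \<le> - T" "y s / s - e \<le> y s' / s'"
      using left[of s] su' 5 c by auto
    have "?H - ?E \<le> chord (\<lambda>r. y (- r)) 0 (- u) (- s)"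
    proof (rule chord_far_ge[where u'="- s'"])
      show "?H \<le> chord (\<lambda>r. y (- r)) 0 (- u) (- s')"
        unfolding chord_reflect using 5 s' \<tau> c su' by (intro H) auto
    qed (use 5 s' \<tau> c su' H0 yK far in auto)
    then show ?thesis by (simp only: chord_reflect)
  qed
qed

lemma gcm_antimono:
  assumes "S \<subseteq> S'" "is_interval S" "is_interval S'" "t \<in> interior S"
    and m: "\<And>s u. (s, u) \<in> chord_pairs S' t \<Longrightarrow> m \<le> chord x t s u"
  shows "gcm S' x t \<le> gcm S x t"
  using assms interior_mono[OF assms(1)]
  by (intro gcm_greatest gcm_lower[of S' t m]) (auto simp: chord_pairs_def)

text \<open>A nearly optimal chord over the line is a chord over every large window; windows in turn
  have fewer chords, so their values stay above the limit.\<close>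

lemma gcm_intervals_tendsto:
  assumes "lower_hull UNIV x 0 \<noteq> - \<infinity>"
  shows "(\<lambda>k. gcm {- real (Suc k)..real (Suc k)} x 0) \<longlonglongrightarrow> gcm UNIV x 0"
proof (rule LIMSEQ_I)
  fix e :: real assume e: "0 < e"
  have G: "ereal (gcm UNIV x 0) = lower_hull UNIV x 0" using assms by (intro ereal_gcm) auto
  have m: "gcm UNIV x 0 \<le> chord x 0 s u" if "(s, u) \<in> chord_pairs UNIV 0" for s u
    using lower_hull_lower[OF that, of x] by (simp add: G[symmetric])
  have "lower_hull UNIV x 0 < ereal (gcm UNIV x 0 + e)" using e by (simp add: G[symmetric])
  then obtain s u where su: "(s, u) \<in> chord_pairs UNIV 0" "chord x 0 s u < gcm UNIV x 0 + e"
    unfolding lower_hull_def by (auto simp: INF_less_iff)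
  obtain k0 :: nat where k0: "max \<bar>s\<bar> \<bar>u\<bar> \<le> real k0" using real_arch_simple by blast
  have "norm (gcm {- real (Suc k)..real (Suc k)} x 0 - gcm UNIV x 0) < e" if k: "k0 \<le> k" for k
  proof -
    have "real k0 \<le> real k" using k by simp
    then have "(s, u) \<in> chord_pairs {- real (Suc k)..real (Suc k)} 0"
      using su(1) k0 by (auto simp: chord_pairs_def)
    moreover have int: "0 \<in> interior {- real (Suc k)..real (Suc k)}"
      by (intro zero_in_interior_interval) simp
    moreover have "gcm UNIV x 0 \<le> chord x 0 s u" if "(s, u) \<in> chord_pairs {- real (Suc k)..real (Suc k)} 0" for s u
      using that by (intro m) (simp add: chord_pairs_def)
    ultimately have "gcm {- real (Suc k)..real (Suc k)} x 0 \<le> chord x 0 s u"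
      by (intro gcm_lower[OF is_interval_cc])
    moreover have "gcm UNIV x 0 \<le> gcm {- real (Suc k)..real (Suc k)} x 0"
      by (rule gcm_antimono[OF _ is_interval_cc _ int m]) simp_all
    ultimately show ?thesis using su(2) by simp
  qed
  then show "\<exists>no. \<forall>k\<ge>no. norm (gcm {- real (Suc k)..real (Suc k)} x 0 - gcm UNIV x 0) < e" by blast
qed

section \<open>Rescaling about the base point\<close>

lemma local_domain_iff: "0 < d \<Longrightarrow> s \<in> local_domain J t0 d \<longleftrightarrow> t0 + s * d \<in> J"
  unfolding local_domain_def by (auto simp: image_iff intro!: bexI[of _ "t0 + s * d"])

lemma is_interval_local_domain:
  assumes "is_interval J" "0 < d" shows "is_interval (local_domain J t0 d)"
  unfolding is_interval_1
proof (intro ballI allI impI)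
  fix a b x assume *: "a \<in> local_domain J t0 d" "b \<in> local_domain J t0 d" "a \<le> x \<and> x \<le> b"
  then have "t0 + a * d \<in> J" "t0 + b * d \<in> J" "t0 + a * d \<le> t0 + x * d" "t0 + x * d \<le> t0 + b * d"
    using assms(2) by (auto simp: local_domain_iff)
  then show "x \<in> local_domain J t0 d"
    using assms unfolding is_interval_1 local_domain_iff[OF assms(2)] by blast
qed

lemma local_domain_eventually:
  assumes t0: "t0 \<in> interior J" and d: "\<And>n. 0 < d n" "d \<longlonglongrightarrow> 0"
  shows "\<forall>\<^sub>F n in sequentially. {- c..c} \<subseteq> local_domain J t0 (d n)"
proof -
  obtain r where r: "0 < r" "ball t0 r \<subseteq> J" using t0 by (auto simp: mem_interior)
  have "(\<lambda>n. \<bar>c\<bar> * d n) \<longlonglongrightarrow> \<bar>c\<bar> * 0" by (intro tendsto_intros d)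
  then have "\<forall>\<^sub>F n in sequentially. \<bar>c\<bar> * d n < r" using r(1) by (intro order_tendstoD) auto
  then show ?thesis
  proof eventually_elim
    case (elim n)
    show ?case
    proof
      fix s assume "s \<in> {- c..c}"
      then have "\<bar>s\<bar> * d n \<le> \<bar>c\<bar> * d n" using d(1)[of n] by (intro mult_right_mono) auto
      then have "\<bar>s * d n\<bar> < r" using elim d(1)[of n] unfolding abs_mult by linarith
      then have "t0 + s * d n \<in> ball t0 r" by (simp add: dist_real_def)
      then show "s \<in> local_domain J t0 (d n)" using r(2) d(1) by (auto simp: local_domain_iff)
    qed
  qed
qed

lemma zero_interior_local_domain:
  fixes d t0 :: real
  assumes t0: "t0 \<in> interior J" and d: "0 < d"
  shows "0 \<in> interior (local_domain J t0 d)"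
proof -
  obtain r where r: "0 < r" "ball t0 r \<subseteq> J" using t0 by (auto simp: mem_interior)
  have "ball 0 (r / d) \<subseteq> local_domain J t0 d"
  proof
    fix s :: real assume "s \<in> ball 0 (r / d)"
    then have "\<bar>s\<bar> * d < r" using d by (simp add: pos_less_divide_eq)
    then have "\<bar>s * d\<bar> < r" using d by (simp add: abs_mult)
    then have "t0 + s * d \<in> ball t0 r" by (simp add: dist_real_def)
    then show "s \<in> local_domain J t0 d" using r(2) d by (auto simp: local_domain_iff)
  qed
  then show ?thesis using r(1) d unfolding mem_interior by (intro exI[of _ "r / d"]) auto
qed

text \<open>The change of variable is a bijection between chords over \<open>J\<close> at
  \<open>t0\<close> and chords over the rescaled domain at 0. The term with \<open>l\<close>
  vanishes at 0, so by \<open>chord_affine\<close> any slope \<open>l\<close> leaves the chord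
  values unchanged.\<close>

lemma gcm_local_domain:
  assumes J: "is_interval J" "t0 \<in> interior J" and d: "0 < d" and a: "0 < a"
    and y: "y = (\<lambda>s. a * (x (t0 + s * d) - x t0 - l * s * d))"
    and m: "\<And>s u. (s, u) \<in> chord_pairs (local_domain J t0 d) 0 \<Longrightarrow> m \<le> chord y 0 s u"
  shows "gcm (local_domain J t0 d) y 0 = a * (gcm J x t0 - x t0)"
proof -
  let ?I = "local_domain J t0 d"
  note I = is_interval_local_domain[OF J(1) d, of t0] zero_interior_local_domain[OF J(2) d]
  have ch: "chord y 0 s u = a * (chord x t0 (t0 + s * d) (t0 + u * d) - x t0)" if "s < u" for s u
  proof -
    have "chord (\<lambda>r. x (t0 + r * d)) 0 s u = chord x t0 (t0 + s * d) (t0 + u * d)"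
    proof -
      have "(t0 + u * d - t0) * x (t0 + s * d) + (t0 - (t0 + s * d)) * x (t0 + u * d)
          = d * ((u - 0) * x (t0 + s * d) + (0 - s) * x (t0 + u * d))"
        "t0 + u * d - (t0 + s * d) = d * (u - s)" by (simp_all add: algebra_simps)
      then show ?thesis using d by (simp only: chord_def mult_divide_mult_cancel_left[OF less_imp_neq[OF d, symmetric]])
    qed
    moreover have "y = (\<lambda>r. a * x (t0 + r * d) + (- a * x t0) + (- a * l * d) * (r - 0))"
      by (auto simp: y algebra_simps)
    ultimately show ?thesis
      using chord_affine[OF that, of a "\<lambda>r. x (t0 + r * d)" "- a * x t0" "- a * l * d" 0]
      by (simp add: algebra_simps)
  qed
  have pairs': "(s, u) \<in> chord_pairs ?I 0 \<longleftrightarrow> (t0 + s * d, t0 + u * d) \<in> chord_pairs J t0" for s u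
    using d by (auto simp: chord_pairs_def local_domain_iff mult_le_0_iff zero_le_mult_iff)
  have pairs: "((s - t0) / d, (u - t0) / d) \<in> chord_pairs ?I 0 \<longleftrightarrow> (s, u) \<in> chord_pairs J t0" for s u
    using d by (simp add: pairs')
  have ch': "chord x t0 s u = chord y 0 ((s - t0) / d) ((u - t0) / d) / a + x t0"
    if "(s, u) \<in> chord_pairs J t0" for s u
    using that ch[of "(s - t0) / d" "(u - t0) / d"] a d by (simp add: chord_pairs_def divide_strict_right_mono)
  have mJ: "m / a + x t0 \<le> chord x t0 s u" if "(s, u) \<in> chord_pairs J t0" for s u
    using m[of "(s - t0) / d" "(u - t0) / d"] that a by (simp add: pairs ch' divide_right_mono)
  show ?thesis
  proof (rule antisym)
    show "a * (gcm J x t0 - x t0) \<le> gcm ?I y 0"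
    proof (rule gcm_greatest[OF I])
      fix s u assume su: "(s, u) \<in> chord_pairs ?I 0"
      then have "gcm J x t0 \<le> chord x t0 (t0 + s * d) (t0 + u * d)"
        using mJ by (intro gcm_lower[OF J, of "m / a + x t0"]) (auto simp: pairs')
      then show "a * (gcm J x t0 - x t0) \<le> chord y 0 s u"
        using su a by (simp add: ch chord_pairs_def)
    qed
    have "gcm ?I y 0 / a + x t0 \<le> gcm J x t0"
    proof (rule gcm_greatest[OF J])
      fix s u assume su: "(s, u) \<in> chord_pairs J t0"
      show "gcm ?I y 0 / a + x t0 \<le> chord x t0 s u"
        unfolding ch'[OF su] using su a m by (auto intro!: divide_right_mono gcm_lower[OF I, of m] simp: pairs)
    qed
    then show "gcm ?I y 0 \<le> a * (gcm J x t0 - x t0)" using a by (simp add: field_simps)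
  qed
qed

lemma const_extension_in [simp]: "s \<in> I \<Longrightarrow> const_extension I x s = x s"
  by (simp add: const_extension_def)

section \<open>Weak convergence by approximation\<close>

lemma cts_step_bounds: "a < b \<Longrightarrow> 0 \<le> cts_step a b x" "a < b \<Longrightarrow> cts_step a b x \<le> 1"
  by (auto simp: cts_step_def divide_simps)

lemma cts_step_Lipschitz:
  assumes ab: "a < b"
  shows "\<bar>cts_step a b x - cts_step a b y\<bar> \<le> \<bar>x - y\<bar> / (b - a)"
proof -
  define l where "l r = (b - r) / (b - a)" for r
  \<comment> \<open>The step is an affine function clamped to \<open>[0, 1]\<close>, and clamping
    does not increase distances.\<close>
  have "cts_step a b r = min 1 (max 0 (l r))" for r
    using ab by (auto simp: cts_step_def l_def divide_simps min_def max_def)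
  then have "\<bar>cts_step a b x - cts_step a b y\<bar> \<le> \<bar>l x - l y\<bar>"
    by (auto simp: min_def max_def)
  also have "l x - l y = (y - x) / (b - a)"
    by (simp add: l_def diff_divide_distrib[symmetric])
  finally show ?thesis using ab by (simp add: abs_minus_commute abs_divide)
qed

lemma measurable_cts_step [measurable]: "a < b \<Longrightarrow> cts_step a b \<in> borel_measurable borel"
  by (intro borel_measurable_continuous_onI uniformly_continuous_imp_continuous cts_step_uniformly_continuous)

text \<open>Where the variables are within \<open>e\<close> of each other, the Lipschitz constant
  \<open>1 / (b - a)\<close> applies; elsewhere the steps differ by at most 1.\<close>

lemma (in prob_space) expectation_cts_step_diff:
  assumes [measurable]: "X \<in> borel_measurable M" "Z \<in> borel_measurable M"
    and ab: "a < b" and e: "0 \<le> e"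
  shows "\<bar>expectation (\<lambda>\<omega>. cts_step a b (X \<omega>)) - expectation (\<lambda>\<omega>. cts_step a b (Z \<omega>))\<bar>
    \<le> e / (b - a) + prob {\<omega> \<in> space M. e < \<bar>Z \<omega> - X \<omega>\<bar>}" (is "_ \<le> _ + prob ?A")
proof -
  note [measurable] = measurable_cts_step[OF ab]
  have int: "integrable M (\<lambda>\<omega>. cts_step a b (W \<omega>))" if [measurable]: "W \<in> borel_measurable M" for W
    using cts_step_bounds[OF ab] by (intro integrable_const_bound[of _ 1]) (auto simp: abs_le_iff intro!: AE_I2)
  have A[measurable]: "?A \<in> events" by measurable
  have le: "\<bar>cts_step a b (X \<omega>) - cts_step a b (Z \<omega>)\<bar> \<le> e / (b - a) + indicator ?A \<omega>"
    if "\<omega> \<in> space M" for \<omega>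
  proof (cases "\<omega> \<in> ?A")
    case True
    have "\<bar>cts_step a b (X \<omega>) - cts_step a b (Z \<omega>)\<bar> \<le> 1"
      using cts_step_bounds[OF ab, of "X \<omega>"] cts_step_bounds[OF ab, of "Z \<omega>"] by (simp add: abs_le_iff)
    moreover have "0 \<le> e / (b - a)" using e ab by simp
    ultimately show ?thesis using True by simp
  next
    case False
    then have "\<bar>X \<omega> - Z \<omega>\<bar> \<le> e" using that by auto
    then have "\<bar>X \<omega> - Z \<omega>\<bar> / (b - a) \<le> e / (b - a)" using ab by (intro divide_right_mono) auto
    then show ?thesis using cts_step_Lipschitz[OF ab, of "X \<omega>" "Z \<omega>"] False by simp
  qed
  have "\<bar>expectation (\<lambda>\<omega>. cts_step a b (X \<omega>)) - expectation (\<lambda>\<omega>. cts_step a b (Z \<omega>))\<bar>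
      = \<bar>expectation (\<lambda>\<omega>. cts_step a b (X \<omega>) - cts_step a b (Z \<omega>))\<bar>"
    by (subst Bochner_Integration.integral_diff) (auto intro!: int)
  also have "\<dots> \<le> expectation (\<lambda>\<omega>. \<bar>cts_step a b (X \<omega>) - cts_step a b (Z \<omega>)\<bar>)"
    by (rule integral_abs_bound)
  also have "\<dots> \<le> expectation (\<lambda>\<omega>. e / (b - a) + indicator ?A \<omega>)"
    using le by (intro integral_mono integrable_abs Bochner_Integration.integrable_diff int
        Bochner_Integration.integrable_add) (auto simp: emeasure_eq_measure)
  also have "\<dots> = e / (b - a) + prob ?A"
    by (subst Bochner_Integration.integral_add) (auto simp: emeasure_eq_measure prob_space)
  finally show ?thesis .
qed

text \<open>Billingsley, Convergence of Probability Measures, Theorem 3.2.\<close>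

lemma weak_conv_m_approximation:
  fixes X :: "nat \<Rightarrow> 'a \<Rightarrow> real" and Y :: "'b \<Rightarrow> real"
  assumes prob: "\<And>n. prob_space (M n)" "prob_space N"
    and X [measurable]: "\<And>n. X n \<in> borel_measurable (M n)" and Y [measurable]: "Y \<in> borel_measurable N"
    and Z [measurable]: "\<And>k n. Z k n \<in> borel_measurable (M n)"
    and W [measurable]: "\<And>k. W k \<in> borel_measurable N"
    and ZW: "\<And>k a b. a < b \<Longrightarrow>
        (\<lambda>n. \<integral>\<omega>. cts_step a b (Z k n \<omega>) \<partial>M n) \<longlonglongrightarrow> (\<integral>\<omega>. cts_step a b (W k \<omega>) \<partial>N)"
    and WY: "AE \<omega> in N. (\<lambda>k. W k \<omega>) \<longlonglongrightarrow> Y \<omega>"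
    and ZX: "\<And>\<epsilon> \<delta>. 0 < \<epsilon> \<Longrightarrow> 0 < \<delta> \<Longrightarrow> \<forall>\<^sub>F k in sequentially. \<forall>\<^sub>F n in sequentially.
        measure (M n) {\<omega> \<in> space (M n). \<epsilon> < \<bar>Z k n \<omega> - X n \<omega>\<bar>} < \<delta>"
  shows "weak_conv_m (\<lambda>n. distr (M n) borel (X n)) (distr N borel Y)"
proof (rule integral_cts_step_conv_imp_weak_conv)
  fix a b :: real assume ab: "a < b"
  note [measurable] = measurable_cts_step[OF ab]
  interpret N: prob_space N by (rule prob)
  have cont: "continuous_on UNIV (cts_step a b)"
    using ab by (intro uniformly_continuous_imp_continuous cts_step_uniformly_continuous)
  have "(\<lambda>k. \<integral>\<omega>. cts_step a b (W k \<omega>) \<partial>N) \<longlonglongrightarrow> (\<integral>\<omega>. cts_step a b (Y \<omega>) \<partial>N)"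
  proof (rule integral_dominated_convergence[where w="\<lambda>_. 1"])
    show "AE \<omega> in N. (\<lambda>k. cts_step a b (W k \<omega>)) \<longlonglongrightarrow> cts_step a b (Y \<omega>)"
      using WY by eventually_elim (rule continuous_on_tendsto_compose[OF cont], auto)
    show "AE \<omega> in N. norm (cts_step a b (W k \<omega>)) \<le> 1" for k
      using cts_step_bounds[OF ab] by (auto simp: abs_le_iff intro!: AE_I2)
  qed auto
  note WY' = this
  have "(\<lambda>n. \<integral>\<omega>. cts_step a b (X n \<omega>) \<partial>M n) \<longlonglongrightarrow> (\<integral>\<omega>. cts_step a b (Y \<omega>) \<partial>N)"
  proof (rule tendstoI)
    fix e :: real assume e: "0 < e"
    \<comment> \<open>A quarter of \<open>e\<close> goes to each of the Lipschitz error, the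
      exceptional event, the convergence of \<open>Z k\<close> to \<open>W k\<close>, and the
      distance from \<open>W k\<close> to \<open>Y\<close>.\<close>
    define \<epsilon> where "\<epsilon> = (e / 4) * (b - a)"
    have \<epsilon>: "0 < \<epsilon>" "\<epsilon> / (b - a) = e / 4"
      using e ab by (simp_all only: \<epsilon>_def nonzero_mult_div_cancel_right) auto
    have "\<forall>\<^sub>F k in sequentially. \<bar>(\<integral>\<omega>. cts_step a b (W k \<omega>) \<partial>N) - (\<integral>\<omega>. cts_step a b (Y \<omega>) \<partial>N)\<bar> < e / 4"
      using tendstoD[OF WY', of "e / 4"] e by (simp add: dist_real_def)
    moreover have "\<forall>\<^sub>F k in sequentially. \<forall>\<^sub>F n in sequentially.
        measure (M n) {\<omega> \<in> space (M n). \<epsilon> < \<bar>Z k n \<omega> - X n \<omega>\<bar>} < e / 4"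
      using e \<epsilon> by (intro ZX) auto
    ultimately have "\<forall>\<^sub>F k in sequentially. \<bar>(\<integral>\<omega>. cts_step a b (W k \<omega>) \<partial>N) - (\<integral>\<omega>. cts_step a b (Y \<omega>) \<partial>N)\<bar> < e / 4
      \<and> (\<forall>\<^sub>F n in sequentially. measure (M n) {\<omega> \<in> space (M n). \<epsilon> < \<bar>Z k n \<omega> - X n \<omega>\<bar>} < e / 4)"
      by eventually_elim simp
    then obtain k where
      k1: "\<bar>(\<integral>\<omega>. cts_step a b (W k \<omega>) \<partial>N) - (\<integral>\<omega>. cts_step a b (Y \<omega>) \<partial>N)\<bar> < e / 4" and
      k2: "\<forall>\<^sub>F n in sequentially. measure (M n) {\<omega> \<in> space (M n). \<epsilon> < \<bar>Z k n \<omega> - X n \<omega>\<bar>} < e / 4"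
      unfolding eventually_sequentially by blast
    have "\<forall>\<^sub>F n in sequentially. \<bar>(\<integral>\<omega>. cts_step a b (Z k n \<omega>) \<partial>M n) - (\<integral>\<omega>. cts_step a b (W k \<omega>) \<partial>N)\<bar> < e / 4"
      using tendstoD[OF ZW[OF ab], of "e / 4" k] e by (simp add: dist_real_def)
    with k2 show "\<forall>\<^sub>F n in sequentially.
        dist (\<integral>\<omega>. cts_step a b (X n \<omega>) \<partial>M n) (\<integral>\<omega>. cts_step a b (Y \<omega>) \<partial>N) < e"
    proof eventually_elim
      case (elim n)
      then show ?case
        using prob_space.expectation_cts_step_diff[OF prob(1)[of n] X Z ab less_imp_le[OF \<epsilon>(1)], of k] k1
        unfolding \<epsilon>(2) dist_real_def by linarith
    qed
  qed
  then show "(\<lambda>n. integral\<^sup>L (distr (M n) borel (X n)) (cts_step a b))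
      \<longlonglongrightarrow> integral\<^sup>L (distr N borel Y) (cts_step a b)"
    by (simp add: integral_distr)
next
  show "real_distribution (distr (M n) borel (X n))" for n
    by (intro prob_space.real_distribution_distr prob X)
  show "real_distribution (distr N borel Y)"
    by (intro prob_space.real_distribution_distr prob Y)
qed

text \<open>Convergence in law speaks only of bounded continuous ball-measurable functionals, so the
  event is replaced by a ramp in the distance to \<open>z\<close>, rising from 0 at \<open>K\<close>
  to 1 at \<open>K + 1\<close>. Its mean under the limit vanishes as \<open>K\<close> grows, and it
  dominates the indicator of distances above \<open>K + 1\<close>; hence the final bound is
  \<open>m + 1\<close>.\<close>

lemma unif_dist_tight:
  assumes prob: "\<And>n. prob_space (M n)" "prob_space N"
    and conv: "converges_in_law (cadlag UNIV) loc_unif_dist M X N Y"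
    and z: "z \<in> cadlag UNIV" and \<delta>: "0 < \<delta>"
  shows "\<exists>K\<ge>0. \<forall>\<^sub>F n in sequentially.
    measure (M n) {\<omega> \<in> space (M n). K < unif_dist (Suc k) z (X n \<omega>)} < \<delta>"
proof -
  interpret N: prob_space N by (rule prob)
  let ?u = "unif_dist (Suc k) z"
  note u [measurable] = measurable_unif_dist[OF z, of k]
  have X [measurable]: "X n \<in> M n \<rightarrow>\<^sub>M D_sigma" and Y [measurable]: "Y \<in> N \<rightarrow>\<^sub>M D_sigma" for n
    using conv by (auto simp: converges_in_law_def)
  define f where "f K w = min 1 (max 0 (?u w - K))" for K :: real and w
  have f [measurable]: "f K \<in> borel_measurable D_sigma" for K unfolding f_def[abs_def] by measurable
  have f01: "0 \<le> f K w" "f K w \<le> 1" for K w by (auto simp: f_def)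
  have fc: "continuous_map D.mtopology euclideanreal (f K)" for K
  proof (rule continuous_map_unif_dist_Lipschitz[where L=1 and k=k])
    fix v w assume vw: "v \<in> cadlag UNIV" "w \<in> cadlag UNIV"
    have "unif_dist (Suc k) v w = unif_dist (Suc k) w v"
      by (simp add: unif_dist_def abs_minus_commute)
    then have "\<bar>?u v - ?u w\<bar> \<le> unif_dist (Suc k) v w"
      using unif_dist_triangle[OF z vw, of "Suc k"] unif_dist_triangle[OF z vw(2,1), of "Suc k"] by linarith
    moreover have "\<bar>f K v - f K w\<bar> \<le> \<bar>?u v - ?u w\<bar>" by (auto simp: f_def min_def max_def)
    ultimately show "\<bar>f K v - f K w\<bar> \<le> 1 * unif_dist (Suc k) v w" by simp
  qed
  have "(\<lambda>m. \<integral>\<omega>. f (real m) (Y \<omega>) \<partial>N) \<longlonglongrightarrow> (\<integral>\<omega>. 0 \<partial>N)"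
  proof (rule integral_dominated_convergence[where w="\<lambda>_. 1"])
    have "(\<lambda>m. f (real m) (Y \<omega>)) \<longlonglongrightarrow> 0" for \<omega>
    proof (rule tendsto_eventually)
      have "\<forall>\<^sub>F m in sequentially. ?u (Y \<omega>) \<le> real m"
        using filterlim_real_sequentially by (auto simp: filterlim_at_top)
      then show "\<forall>\<^sub>F m in sequentially. f (real m) (Y \<omega>) = 0"
        by eventually_elim (auto simp: f_def)
    qed
    then show "AE \<omega> in N. (\<lambda>m. f (real m) (Y \<omega>)) \<longlonglongrightarrow> 0" by simp
  qed (use f01 in auto)
  then have "\<forall>\<^sub>F m in sequentially. (\<integral>\<omega>. f (real m) (Y \<omega>) \<partial>N) < \<delta>"
    using \<delta> by (intro order_tendstoD) auto
  then obtain m :: nat where m: "(\<integral>\<omega>. f (real m) (Y \<omega>) \<partial>N) < \<delta>"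
    by (auto simp: eventually_sequentially)
  have "bounded (f (real m) ` cadlag UNIV)"
    using f01 by (intro boundedI[where B=1]) auto
  then have "(\<lambda>n. \<integral>\<omega>. f (real m) (X n \<omega>) \<partial>M n) \<longlonglongrightarrow> (\<integral>\<omega>. f (real m) (Y \<omega>) \<partial>N)"
    using conv fc f unfolding converges_in_law_def by blast
  then have "\<forall>\<^sub>F n in sequentially. (\<integral>\<omega>. f (real m) (X n \<omega>) \<partial>M n) < \<delta>"
    using m by (intro order_tendstoD)
  then have "\<forall>\<^sub>F n in sequentially. measure (M n) {\<omega> \<in> space (M n). real m + 1 < ?u (X n \<omega>)} < \<delta>"
  proof eventually_elim
    case (elim n)
    interpret P: prob_space "M n" by (rule prob)
    let ?A = "{\<omega> \<in> space (M n). real m + 1 < ?u (X n \<omega>)}"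
    have A: "?A \<in> sets (M n)" by measurable
    have "measure (M n) ?A = (\<integral>\<omega>. indicator ?A \<omega> \<partial>M n)" using A by simp
    also have "\<dots> \<le> (\<integral>\<omega>. f (real m) (X n \<omega>) \<partial>M n)"
    proof (intro integral_mono)
      show "integrable (M n) (indicator ?A :: _ \<Rightarrow> real)" using A by (simp add: P.emeasure_eq_measure)
      show "integrable (M n) (\<lambda>\<omega>. f (real m) (X n \<omega>))"
        using f01 by (intro P.integrable_const_bound[of _ 1]) (auto simp: abs_le_iff intro!: AE_I2)
      show "indicator ?A \<omega> \<le> f (real m) (X n \<omega>)" if "\<omega> \<in> space (M n)" for \<omega>
        using f01[of "real m" "X n \<omega>"] by (auto simp: f_def indicator_def)
    qed
    finally show ?case using elim by simp
  qed
  then show ?thesis by (intro exI[of _ "real m + 1"]) auto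
qed

text \<open>The infimum over \<open>A\<close> need not be attained, hence the slack
  \<open>e < e'\<close>. An empty \<open>A\<close>, or an infimum \<open>-\<infinity>\<close> over
  \<open>B\<close>, would make the difference \<open>\<infinity>\<close> in \<open>ereal\<close>,
  against the hypothesis.\<close>

lemma INF_diff_leD:
  fixes f :: "real \<Rightarrow> real"
  assumes "\<not> (INF s\<in>A. ereal (f s)) - (INF s\<in>B. ereal (f s)) > ereal e" and u: "u \<in> B" and e: "e < e'"
  shows "\<exists>s\<in>A. f s \<le> f u + e'"
proof -
  have "(INF s\<in>B. ereal (f s)) \<le> ereal (f u)" using u by (rule INF_lower)
  then have "(INF s\<in>A. ereal (f s)) < ereal (f u + e')"
    using assms(1) e by (cases "INF s\<in>A. ereal (f s)"; cases "INF s\<in>B. ereal (f s)") auto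
  then obtain s where "s \<in> A" "f s < f u + e'" unfolding INF_less_iff by auto
  then show ?thesis by (intro bexI[of _ s]) auto
qed

lemma SUP_diff_geD:
  fixes f :: "real \<Rightarrow> real"
  assumes "\<not> (SUP s\<in>A. ereal (f s)) - (SUP s\<in>B. ereal (f s)) < ereal (- e)" and u: "u \<in> B" and e: "e < e'"
  shows "\<exists>s\<in>A. f u - e' \<le> f s"
proof -
  have "ereal (f u) \<le> (SUP s\<in>B. ereal (f s))" using u by (rule SUP_upper)
  then have "ereal (f u - e') < (SUP s\<in>A. ereal (f s))"
    using assms(1) e by (cases "SUP s\<in>A. ereal (f s)"; cases "SUP s\<in>B. ereal (f s)") auto
  then obtain s where "s \<in> A" "f u - e' < f s" unfolding less_SUP_iff by auto
  then show ?thesis by (intro bexI[of _ s]) auto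
qed

lemma is_interval_Collect_bounds:
  fixes I :: "real set"
  assumes I: "is_interval I"
  shows "is_interval {s \<in> I. a \<le> s \<and> s \<le> b}" "is_interval {s \<in> I. a \<le> s}" "is_interval {s \<in> I. s \<le> b}"
  using I unfolding is_interval_1 by (auto; meson order_trans)+

lemma right_continuous_local_domain:
  assumes x: "x \<in> cadlag J" and d: "0 < d" and s: "s \<in> local_domain J t0 d"
  shows "((\<lambda>s. x (t0 + s * d)) \<longlongrightarrow> x (t0 + s * d)) (at s within local_domain J t0 d \<inter> {s<..})"
proof (rule filterlim_compose[OF cadlag_right[OF x, of "t0 + s * d"]])
  show "t0 + s * d \<in> J" using s d by (simp add: local_domain_iff)
  show "filterlim (\<lambda>s. t0 + s * d) (at (t0 + s * d) within J \<inter> {t0 + s * d<..})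
      (at s within local_domain J t0 d \<inter> {s<..})"
    unfolding filterlim_at
    using d by (auto simp: eventually_at_filter local_domain_iff intro!: always_eventually tendsto_intros)
qed

section \<open>The limit theorem\<close>

theorem theorem1:
  fixes J :: "real set" and t0 p A :: real and d :: "nat \<Rightarrow> real"
    and M :: "nat \<Rightarrow> 'a measure" and N :: "'b measure"
    and xb :: "nat \<Rightarrow> real \<Rightarrow> real"
    and v x y vt :: "nat \<Rightarrow> 'a \<Rightarrow> real \<Rightarrow> real"
    and X :: "nat \<Rightarrow> 'a \<Rightarrow> real" and Y :: "'b \<Rightarrow> real"
    and vlim :: "'b \<Rightarrow> real \<Rightarrow> real"
    and I :: "nat \<Rightarrow> real set" and g :: "nat \<Rightarrow> real \<Rightarrow> real"
  assumes J: "is_interval J" and t0: "t0 \<in> interior J"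
    and p: "1 < p"
    and d: "\<And>n. 0 < d n" "decseq d" "d \<longlonglongrightarrow> 0"
    and prob: "\<And>n. prob_space (M n)" "prob_space N"
    and v_measurable: "\<And>n t. t \<in> J \<Longrightarrow> (\<lambda>\<omega>. v n \<omega> t) \<in> borel_measurable (M n)"
    and v_cadlag: "\<And>n \<omega>. \<omega> \<in> space (M n) \<Longrightarrow> v n \<omega> \<in> cadlag J"
    and x_def: "x = (\<lambda>n \<omega> t. xb n t + v n \<omega> t)"
    and x_cadlag: "\<And>n \<omega>. \<omega> \<in> space (M n) \<Longrightarrow> x n \<omega> \<in> cadlag J"
    and x_bounded_below: "\<And>n. AE \<omega> in M n. bdd_below (x n \<omega> ` J)"
    and xb_diff: "\<And>n. xb n differentiable (at t0)"
    and I_def: "I = (\<lambda>n. local_domain J t0 (d n))"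
    and vt_def: "vt = (\<lambda>n \<omega>. local_noise p t0 (d n) (v n \<omega>))"
    and g_def: "g = (\<lambda>n. local_drift p t0 (d n) (xb n))"
    and y_def: "y = (\<lambda>n \<omega> s. g n s + vt n \<omega> s)"
    and A1_nonzero: "\<not> (AE \<omega> in N. \<forall>s. vlim \<omega> s = 0)"
    and A1: "converges_in_law (cadlag UNIV) loc_unif_dist
               M (\<lambda>n \<omega>. const_extension (I n) (vt n \<omega>)) N vlim"
    and A2_convex: "\<And>n. convex_on J (xb n)"
    and A2: "0 < A"
      "\<And>c. 0 < c \<Longrightarrow>
         (\<lambda>n. SUP s\<in>{s\<in>I n. \<bar>s\<bar> \<le> c}. ereal \<bar>g n s - A * \<bar>s\<bar> powr p\<bar>) \<longlonglongrightarrow> 0"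
    and A3: "\<And>\<delta>. 0 < \<delta> \<Longrightarrow> \<exists>\<tau>>0. \<exists>\<kappa>>0.
         liminf (\<lambda>n. ereal (measure (M n) {\<omega>\<in>space (M n).
           (INF s\<in>{s\<in>I n. \<tau> \<le> \<bar>s\<bar>}. ereal (y n \<omega> s - \<kappa> * \<bar>s\<bar>)) > 0})) > ereal (1 - \<delta>)"
    and A4: "\<And>\<epsilon> \<delta> \<tau>. 0 < \<epsilon> \<Longrightarrow> 0 < \<delta> \<Longrightarrow> 0 < \<tau> \<Longrightarrow> \<forall>\<^sub>F c in at_top.
         limsup (\<lambda>n. ereal (measure (M n) {\<omega>\<in>space (M n).
           (INF s\<in>{s\<in>I n. \<tau> \<le> s \<and> s \<le> c}. ereal (y n \<omega> s / s))
             - (INF s\<in>{s\<in>I n. \<tau> \<le> s}. ereal (y n \<omega> s / s)) > ereal \<epsilon>})) < ereal \<delta> \<and>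
         limsup (\<lambda>n. ereal (measure (M n) {\<omega>\<in>space (M n).
           (SUP s\<in>{s\<in>I n. - c \<le> s \<and> s \<le> - \<tau>}. ereal (y n \<omega> s / s))
             - (SUP s\<in>{s\<in>I n. s \<le> - \<tau>}. ereal (y n \<omega> s / s)) < ereal (- \<epsilon>)})) < ereal \<delta>"
    and A5: "\<And>\<epsilon> \<delta>. 0 < \<epsilon> \<Longrightarrow> 0 < \<delta> \<Longrightarrow> \<exists>\<tau>>0.
         measure N {\<omega>\<in>space N.
           (SUP s\<in>{s. \<tau> \<le> \<bar>s\<bar>}. ereal \<bar>vlim \<omega> s / (A * \<bar>s\<bar> powr p)\<bar>) > ereal \<epsilon>} \<le> \<delta>"
    and X_def: "X = (\<lambda>n \<omega>. d n powr (- p) * (gcm J (x n \<omega>) t0 - x n \<omega> t0))"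
    and Y_def: "Y = (\<lambda>\<omega>. gcm UNIV (\<lambda>s. A * \<bar>s\<bar> powr p + vlim \<omega> s) 0)"
  shows "(\<forall>n. X n \<in> borel_measurable (M n)) \<and> Y \<in> borel_measurable N \<and>
         weak_conv_m (\<lambda>n. distr (M n) borel (X n)) (distr N borel Y)"
proof -
  define a where "a n = d n powr (- p)" for n
  define b where "b s = A * \<bar>s\<bar> powr p" for s
  define ext where "ext n \<omega> = const_extension (I n) (vt n \<omega>)" for n \<omega>
  \<comment> \<open>The window size \<open>Suc k\<close> matches the index shift in the metric, so
    that \<open>unif_dist (Suc k)\<close> controls \<open>G k\<close>.\<close>
  define G where "G k z = gcm {- real (Suc k)..real (Suc k)} (\<lambda>s. b s + z s) 0" for k z
  note d0 = d(1)
  have a: "0 < a n" for n using d0[of n] by (simp add: a_def)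
  have I: "s \<in> I n \<longleftrightarrow> t0 + s * d n \<in> J" for s n by (simp add: I_def local_domain_iff d0)
  have II: "is_interval (I n)" "0 \<in> interior (I n)" for n
    unfolding I_def by (intro is_interval_local_domain zero_interior_local_domain J t0 d0)+
  have t0J: "t0 \<in> J" using t0 interior_subset by blast
  have y: "y n \<omega> = (\<lambda>s. a n * (x n \<omega> (t0 + s * d n) - x n \<omega> t0 - deriv (xb n) t0 * s * d n))" for n \<omega>
    by (auto simp: y_def g_def vt_def local_drift_def local_noise_def x_def a_def algebra_simps)
  have y0: "y n \<omega> 0 = 0" for n \<omega> by (simp add: y)
  have bc: "b \<in> cadlag UNIV"
    unfolding b_def[abs_def] 
    using p by (intro cadlag_continuous continuous_on_mult continuous_on_powr' continuous_intros) auto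
  have int: "0 \<in> interior {- real (Suc k)..real (Suc k)}" for k
    by (intro zero_in_interior_interval) simp

  \<comment> \<open>Measurability of the variables and of the window functionals\<close>
  have x_meas: "(\<lambda>\<omega>. x n \<omega> t) \<in> borel_measurable (M n)" if "t \<in> J" for n t
    unfolding x_def using v_measurable[OF that, of n] by measurable
  have X_meas: "X n \<in> borel_measurable (M n)" for n
  proof -
    have "(\<lambda>\<omega>. gcm J (x n \<omega>) t0) \<in> borel_measurable (M n)"
      by (rule measurable_gcm[OF J t0]) (auto intro: cadlag_right x_cadlag x_meas)
    then show ?thesis unfolding X_def using x_meas[OF t0J, of n] by measurable
  qed
  have ext_meas: "ext n \<in> M n \<rightarrow>\<^sub>M D_sigma" and vlim_meas: "vlim \<in> N \<rightarrow>\<^sub>M D_sigma" for n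
    using A1 by (auto simp: converges_in_law_def ext_def[abs_def])
  have ext_cadlag: "ext n \<omega> \<in> cadlag UNIV" if "\<omega> \<in> space (M n)" for n \<omega>
    using measurable_space[OF ext_meas that] by simp
  have vlim_cadlag: "vlim \<omega> \<in> cadlag UNIV" if "\<omega> \<in> space N" for \<omega>
    using measurable_space[OF vlim_meas that] by simp
  have Y_meas: "Y \<in> borel_measurable N"
    unfolding Y_def using measurable_compose[OF vlim_meas measurable_gcm_D[OF _ _ bc, of UNIV]]
    by (simp add: b_def)
  have G_meas: "G k \<in> borel_measurable D_sigma" for k
    unfolding G_def[abs_def] by (intro measurable_gcm_D is_interval_cc int bc)
  have G_Lip: "\<bar>G k z - G k w\<bar> \<le> unif_dist (Suc k) z w"
    if "z \<in> cadlag UNIV" "w \<in> cadlag UNIV" for k z w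
    unfolding G_def using that by (intro gcm_interval_Lipschitz bc) auto

  \<comment> \<open>Almost sure finiteness of the limit\<close>
  have vlim_coord: "(\<lambda>\<omega>. vlim \<omega> s) \<in> borel_measurable N" for s
    by (rule measurable_compose[OF vlim_meas measurable_coordinate])
  have vlim_right: "(vlim \<omega> \<longlongrightarrow> vlim \<omega> s) (at s within S \<inter> {s<..})" if "\<omega> \<in> space N" for \<omega> s S
    using cadlag_right[OF vlim_cadlag[OF that], of s] by (rule tendsto_within_subset) auto
  have finite: "AE \<omega> in N. lower_hull UNIV (\<lambda>s. b s + vlim \<omega> s) 0 \<noteq> - \<infinity>"
  proof -
    interpret N: prob_space N by (rule prob)
    let ?B = "{\<omega> \<in> space N. lower_hull UNIV (\<lambda>s. b s + vlim \<omega> s) 0 = - \<infinity>}"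
    have "(\<lambda>\<omega>. lower_hull UNIV (\<lambda>s. b s + vlim \<omega> s) 0) \<in> borel_measurable N"
    proof (rule measurable_lower_hull)
      fix \<omega> s assume "\<omega> \<in> space N"
      then show "((\<lambda>s. b s + vlim \<omega> s) \<longlongrightarrow> b s + vlim \<omega> s) (at s within UNIV \<inter> {s<..})"
        by (intro cadlag_right cadlag_add bc vlim_cadlag) auto
    qed (use vlim_coord in auto)
    then have B: "?B \<in> sets N" by measurable
    have "measure N ?B \<le> \<delta>" if \<delta>: "0 < \<delta>" for \<delta>
    proof -
      define h where "h \<omega> s = \<bar>vlim \<omega> s / (A * \<bar>s\<bar> powr p)\<bar>" for \<omega> s
      \<comment> \<open>Tolerance 1/2 in A5 keeps \<open>b s + vlim \<omega> s\<close> above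
        \<open>b s / 2\<close> far out.\<close>
      obtain \<tau> where \<tau>: "0 < \<tau>" "measure N {\<omega>\<in>space N.
          (SUP s\<in>{s. \<tau> \<le> \<bar>s\<bar>}. ereal (h \<omega> s)) > ereal (1/2)} \<le> \<delta>" (is "measure N ?C \<le> _")
        using A5[of "1/2" \<delta>] \<delta> unfolding h_def by auto
      \<comment> \<open>The measurability lemmas need intervals, so the two tails are treated
        separately.\<close>
      have split: "{s. \<tau> \<le> \<bar>s\<bar>} = {\<tau>..} \<union> {..-\<tau>}" using \<tau> by auto
      have "(\<lambda>\<omega>. SUP s\<in>S. ereal (h \<omega> s)) \<in> borel_measurable N"
        if S: "is_interval S" "0 \<notin> S" for S
        unfolding h_def using S vlim_coord \<tau> A2(1) p
        by (intro measurable_SUP_right_continuous tendsto_intros vlim_right) auto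
      from this[of "{\<tau>..}"] this[of "{..-\<tau>}"]
      have "(\<lambda>\<omega>. SUP s\<in>{s. \<tau> \<le> \<bar>s\<bar>}. ereal (h \<omega> s)) \<in> borel_measurable N"
        unfolding split SUP_union using \<tau> by (intro borel_measurable_sup) auto
      then have C: "?C \<in> sets N" by measurable
      \<comment> \<open>Off \<open>?C\<close> the path is nonnegative beyond \<open>\<tau>\<close>
        and bounded on \<open>[-\<tau>, \<tau>]\<close>, so all chords share a lower bound.\<close>
      have "?B \<subseteq> ?C"
      proof
        fix \<omega> assume \<omega>: "\<omega> \<in> ?B"
        show "\<omega> \<in> ?C"
        proof (rule ccontr)
          assume "\<omega> \<notin> ?C"
          then have le: "(SUP s\<in>{s. \<tau> \<le> \<bar>s\<bar>}. ereal (h \<omega> s)) \<le> ereal (1/2)" using \<omega> by (simp add: not_less)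
          have far: "0 \<le> b s + vlim \<omega> s" if "\<tau> \<le> \<bar>s\<bar>" for s
          proof -
            have "ereal (h \<omega> s) \<le> ereal (1/2)" using le that by (auto simp: SUP_le_iff)
            moreover have "0 < b s" using that \<tau> A2(1) by (auto simp: b_def)
            ultimately have "\<bar>vlim \<omega> s\<bar> \<le> b s / 2"
              by (simp add: h_def b_def[symmetric] abs_divide divide_le_eq)
            then show ?thesis using \<open>0 < b s\<close> by linarith
          qed
          obtain K where K: "\<forall>s\<in>{-\<tau>..\<tau>}. \<bar>b s + vlim \<omega> s\<bar> \<le> K"
            using cadlag_bounded[OF cadlag_add[OF bc vlim_cadlag]] \<omega> by blast
          have low: "- max K 0 \<le> b s + vlim \<omega> s" for s
          proof (cases "\<tau> \<le> \<bar>s\<bar>")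
            case True
            then show ?thesis using far[of s] by linarith
          next
            case False
            then have "s \<in> {- \<tau>..\<tau>}" by auto
            with K have "\<bar>b s + vlim \<omega> s\<bar> \<le> K" by blast
            then show ?thesis by linarith
          qed
          have "ereal (- max K 0) \<le> lower_hull UNIV (\<lambda>s. b s + vlim \<omega> s) 0"
            using low by (intro lower_hull_greatest) (auto simp: chord_pairs_def intro!: chord_ge)
          then show False using \<omega> by auto
        qed
      qed
      then have "measure N ?B \<le> measure N ?C" by (intro N.finite_measure_mono C)
      then show ?thesis using \<tau> by linarith
    qed
    then have "measure N ?B = 0" by (meson dual_order.antisym field_le_epsilon measure_nonneg add_0 dense_ge)
    then show ?thesis using B
      by (intro AE_I[of _ _ ?B]) (auto simp: N.emeasure_eq_measure)
  qed

  \<comment> \<open>Convergence in law on a compact window\<close>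
  have ZW: "(\<lambda>n. \<integral>\<omega>. cts_step l r (G k (ext n \<omega>)) \<partial>M n) \<longlonglongrightarrow> (\<integral>\<omega>. cts_step l r (G k (vlim \<omega>)) \<partial>N)"
    if lr: "l < r" for k l r
  proof -
    have "continuous_map D.mtopology euclideanreal (\<lambda>z. cts_step l r (G k z))"
    proof (rule continuous_map_unif_dist_Lipschitz[where L="1 / (r - l)" and k=k])
      fix z w :: "real \<Rightarrow> real" assume zw: "z \<in> cadlag UNIV" "w \<in> cadlag UNIV"
      have "\<bar>G k z - G k w\<bar> / (r - l) \<le> unif_dist (Suc k) z w / (r - l)"
        using lr G_Lip[OF zw, of k] by (intro divide_right_mono) auto
      then show "\<bar>cts_step l r (G k z) - cts_step l r (G k w)\<bar> \<le> 1 / (r - l) * unif_dist (Suc k) z w"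
        using cts_step_Lipschitz[OF lr, of "G k z" "G k w"] by simp
    qed
    moreover have "bounded ((\<lambda>z. cts_step l r (G k z)) ` cadlag UNIV)"
      using cts_step_bounds[OF lr] by (intro boundedI[where B=1]) auto
    moreover have "(\<lambda>z. cts_step l r (G k z)) \<in> borel_measurable D_sigma"
      by (rule measurable_compose[OF G_meas measurable_cts_step[OF lr]])
    ultimately show ?thesis
      using A1 unfolding converges_in_law_def ext_def by blast
  qed

  \<comment> \<open>Probability of a large window error\<close>
  have y_right: "(y n \<omega> \<longlongrightarrow> y n \<omega> s) (at s within I n \<inter> {s<..})"
    if "\<omega> \<in> space (M n)" "s \<in> I n" for n \<omega> s
    unfolding y I_def
    by (intro tendsto_intros right_continuous_local_domain x_cadlag d0 that that(2)[unfolded I_def])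
  have y_meas: "(\<lambda>\<omega>. y n \<omega> s) \<in> borel_measurable (M n)" if "s \<in> I n" for n s
    unfolding y using x_meas[of "t0 + s * d n" n] x_meas[OF t0J, of n] that by (simp add: I)

  have ZX: "\<forall>\<^sub>F k in sequentially. \<forall>\<^sub>F n in sequentially.
      measure (M n) {\<omega> \<in> space (M n). \<epsilon> < \<bar>G k (ext n \<omega>) - X n \<omega>\<bar>} < \<delta>"
    if \<epsilon>: "0 < \<epsilon>" and \<delta>: "0 < \<delta>" for \<epsilon> \<delta>
  proof -
    \<comment> \<open>Four exceptional events, each allowed \<open>\<delta> / 4\<close>:
      \<open>right\<close>, \<open>left\<close>, the failure of \<open>far\<close>, and
      \<open>near\<close>.\<close>
    have \<delta>4: "0 < \<delta> / 4" using \<delta> by simp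
    obtain \<tau> \<kappa> where \<tau>: "0 < \<tau>" and \<kappa>: "0 < \<kappa>" and
      far_ev: "liminf (\<lambda>n. ereal (measure (M n) {\<omega>\<in>space (M n).
           (INF s\<in>{s\<in>I n. \<tau> \<le> \<bar>s\<bar>}. ereal (y n \<omega> s - \<kappa> * \<bar>s\<bar>)) > 0})) > ereal (1 - \<delta> / 4)"
      using A3[OF \<delta>4] by blast
    \<comment> \<open>Tightness is available on integer windows, so \<open>[-\<tau>, \<tau>]\<close>
      is enclosed in one.\<close>
    obtain k0 :: nat where k0: "\<tau> \<le> real k0" using real_arch_simple by blast
    obtain K where K: "0 \<le> K" and
      near_ev: "\<forall>\<^sub>F n in sequentially.
        measure (M n) {\<omega> \<in> space (M n). K < unif_dist (Suc k0) (\<lambda>_. 0) (ext n \<omega>)} < \<delta> / 4"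
      using unif_dist_tight[OF prob A1 _ \<delta>4, of "\<lambda>_. 0" k0]
      unfolding ext_def[symmetric] by (auto simp: cadlag_continuous)
    \<comment> \<open>Chosen so that each of the two losses in \<open>gcm_localization\<close> is at
      most \<open>\<epsilon> / 4\<close>. The bound is \<open>K + 1\<close> because on
      \<open>[-\<tau>, \<tau>]\<close> the drift will only be known to within 1 of the nonnegative
      \<open>b\<close>.\<close>
    define T where "T = 4 * (K + 1) * \<tau> / \<epsilon>"
    define e where "e = \<epsilon> / (4 * \<tau>)"
    have T: "0 < T" and e: "0 < e" using K \<tau> \<epsilon> by (auto simp: T_def e_def)
    have loss: "\<tau> * e + (K + 1) * \<tau> / (T + \<tau>) \<le> \<epsilon> / 2"
    proof -
      have "(K + 1) * \<tau> = \<epsilon> / 4 * T" using \<epsilon> by (simp add: T_def)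
      also have "\<dots> \<le> \<epsilon> / 4 * (T + \<tau>)" using \<epsilon> \<tau> by (intro mult_left_mono) auto
      finally have "(K + 1) * \<tau> / (T + \<tau>) \<le> \<epsilon> / 4" using T \<tau> by (simp add: pos_divide_le_eq)
      moreover have "\<tau> * e = \<epsilon> / 4" using \<tau> by (simp add: e_def)
      ultimately show ?thesis by linarith
    qed
    have e2: "0 < e / 2" using e by simp
    \<comment> \<open>The predicates \<open>right\<close>, \<open>left\<close> and
      \<open>near\<close> describe exceptional paths, \<open>far\<close> good ones. The tolerance
      \<open>e / 2\<close> leaves room to pick actual points with tolerance \<open>e\<close>, since
      infima and suprema need not be attained.\<close>
    define right where "right c n \<omega> \<longleftrightarrow> (INF s\<in>{s\<in>I n. T \<le> s \<and> s \<le> c}. ereal (y n \<omega> s / s))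
             - (INF s\<in>{s\<in>I n. T \<le> s}. ereal (y n \<omega> s / s)) > ereal (e / 2)" for c n \<omega>
    define left where "left c n \<omega> \<longleftrightarrow> (SUP s\<in>{s\<in>I n. - c \<le> s \<and> s \<le> - T}. ereal (y n \<omega> s / s))
             - (SUP s\<in>{s\<in>I n. s \<le> - T}. ereal (y n \<omega> s / s)) < ereal (- (e / 2))" for c n \<omega>
    define far where "far n \<omega> \<longleftrightarrow> (INF s\<in>{s\<in>I n. \<tau> \<le> \<bar>s\<bar>}. ereal (y n \<omega> s - \<kappa> * \<bar>s\<bar>)) > 0" for n \<omega>
    define near where "near n \<omega> \<longleftrightarrow> K < unif_dist (Suc k0) (\<lambda>_. 0) (ext n \<omega>)" for n \<omega>

    have INF_SUP_meas: "(\<lambda>\<omega>. INF s\<in>S. ereal (f \<omega> s)) \<in> borel_measurable (M n)"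
        "(\<lambda>\<omega>. SUP s\<in>S. ereal (f \<omega> s)) \<in> borel_measurable (M n)"
      if "is_interval S" "S \<subseteq> I n" "0 \<notin> S" "f = (\<lambda>\<omega> s. y n \<omega> s / s) \<or> f = (\<lambda>\<omega> s. y n \<omega> s - \<kappa> * \<bar>s\<bar>)" for S n f
    proof -
      have "(f \<omega> \<longlongrightarrow> f \<omega> s) (at s within S \<inter> {s<..})" if "\<omega> \<in> space (M n)" "s \<in> S" for \<omega> s
      proof -
        have "(y n \<omega> \<longlongrightarrow> y n \<omega> s) (at s within S \<inter> {s<..})"
          using that \<open>S \<subseteq> I n\<close> by (intro tendsto_within_subset[OF y_right[of \<omega> n s]]) auto
        then show ?thesis
          using \<open>f = _ \<or> _\<close> that \<open>0 \<notin> S\<close> by (elim disjE; simp only:; intro tendsto_intros) auto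
      qed
      moreover have "(\<lambda>\<omega>. f \<omega> s) \<in> borel_measurable (M n)" if "s \<in> S" for s
        using \<open>f = _ \<or> _\<close> y_meas[of s n] that \<open>S \<subseteq> I n\<close> by (elim disjE) (auto simp: subset_iff)
      ultimately show "(\<lambda>\<omega>. INF s\<in>S. ereal (f \<omega> s)) \<in> borel_measurable (M n)"
        "(\<lambda>\<omega>. SUP s\<in>S. ereal (f \<omega> s)) \<in> borel_measurable (M n)"
        using measurable_INF_right_continuous[OF \<open>is_interval S\<close>, of "M n" f]
          measurable_SUP_right_continuous[OF \<open>is_interval S\<close>, of "M n" f] by blast+
    qed
    note sub = is_interval_Collect_bounds[OF II(1)]
    have right_meas: "{\<omega> \<in> space (M n). right c n \<omega>} \<in> sets (M n)" for c n
    proof -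
      have [measurable]: "(\<lambda>\<omega>. INF s\<in>{s\<in>I n. T \<le> s \<and> s \<le> c}. ereal (y n \<omega> s / s)) \<in> borel_measurable (M n)"
        "(\<lambda>\<omega>. INF s\<in>{s\<in>I n. T \<le> s}. ereal (y n \<omega> s / s)) \<in> borel_measurable (M n)"
        using T by (intro INF_SUP_meas sub; auto)+
      show ?thesis unfolding right_def by measurable
    qed
    have left_meas: "{\<omega> \<in> space (M n). left c n \<omega>} \<in> sets (M n)" for c n
    proof -
      have [measurable]: "(\<lambda>\<omega>. SUP s\<in>{s\<in>I n. - c \<le> s \<and> s \<le> - T}. ereal (y n \<omega> s / s)) \<in> borel_measurable (M n)"
        "(\<lambda>\<omega>. SUP s\<in>{s\<in>I n. s \<le> - T}. ereal (y n \<omega> s / s)) \<in> borel_measurable (M n)"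
        using T by (intro INF_SUP_meas sub; auto)+
      show ?thesis unfolding left_def by measurable
    qed
    have far_meas: "{\<omega> \<in> space (M n). far n \<omega>} \<in> sets (M n)" for n
    proof -
      have split: "{s \<in> I n. \<tau> \<le> \<bar>s\<bar>} = {s \<in> I n. \<tau> \<le> s} \<union> {s \<in> I n. s \<le> - \<tau>}"
        using \<tau> by auto
      have "(\<lambda>\<omega>. INF s\<in>{s \<in> I n. \<tau> \<le> s}. ereal (y n \<omega> s - \<kappa> * \<bar>s\<bar>)) \<in> borel_measurable (M n)"
        "(\<lambda>\<omega>. INF s\<in>{s \<in> I n. s \<le> - \<tau>}. ereal (y n \<omega> s - \<kappa> * \<bar>s\<bar>)) \<in> borel_measurable (M n)"
        using \<tau> by (intro INF_SUP_meas sub; auto)+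
      then have [measurable]: "(\<lambda>\<omega>. INF s\<in>{s \<in> I n. \<tau> \<le> \<bar>s\<bar>}. ereal (y n \<omega> s - \<kappa> * \<bar>s\<bar>)) \<in> borel_measurable (M n)"
        unfolding split INF_union by (intro borel_measurable_inf)
      show ?thesis unfolding far_def by measurable
    qed
    have near_meas: "{\<omega> \<in> space (M n). near n \<omega>} \<in> sets (M n)" for n
    proof -
      have [measurable]: "(\<lambda>\<omega>. unif_dist (Suc k0) (\<lambda>_. 0) (ext n \<omega>)) \<in> borel_measurable (M n)"
        by (rule measurable_compose[OF ext_meas measurable_unif_dist]) (simp add: cadlag_continuous)
      show ?thesis unfolding near_def by measurable
    qed
    have far_ev': "\<forall>\<^sub>F n in sequentially. measure (M n) {\<omega> \<in> space (M n). \<not> far n \<omega>} < \<delta> / 4"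
      using less_LiminfD[OF far_ev]
    proof eventually_elim
      case (elim n)
      interpret P: prob_space "M n" by (rule prob)
      have "{\<omega> \<in> space (M n). \<not> far n \<omega>} = space (M n) - {\<omega> \<in> space (M n). far n \<omega>}" by auto
      then show ?case using elim P.prob_compl[OF far_meas[of n]] by (simp add: far_def)
    qed

    have drift_ev: "\<forall>\<^sub>F n in sequentially. \<forall>s\<in>I n. \<bar>s\<bar> \<le> c \<longrightarrow> \<bar>g n s - b s\<bar> \<le> r"
      if "0 < c" "0 < r" for c r
    proof -
      have "\<forall>\<^sub>F n in sequentially. (SUP s\<in>{s\<in>I n. \<bar>s\<bar> \<le> c}. ereal \<bar>g n s - A * \<bar>s\<bar> powr p\<bar>) < ereal r"
        using that by (intro order_tendstoD(2)[OF A2(2)]) auto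
      then show ?thesis
      proof eventually_elim
        case (elim n)
        show ?case
        proof (intro ballI impI)
          fix s assume "s \<in> I n" "\<bar>s\<bar> \<le> c"
          then have "ereal \<bar>g n s - A * \<bar>s\<bar> powr p\<bar> \<le> (SUP s\<in>{s\<in>I n. \<bar>s\<bar> \<le> c}. ereal \<bar>g n s - A * \<bar>s\<bar> powr p\<bar>)"
            by (intro SUP_upper) auto
          then have "ereal \<bar>g n s - A * \<bar>s\<bar> powr p\<bar> < ereal r" using elim by (rule le_less_trans)
          then show "\<bar>g n s - b s\<bar> \<le> r" by (simp add: b_def)
        qed
      qed
    qed

    \<comment> \<open>A4 holds for all large real \<open>c\<close>; it is used along the window
      sizes \<open>Suc k\<close>.\<close>
    have "filterlim (\<lambda>k. real (Suc k)) at_top sequentially"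
      by (rule filterlim_compose[OF filterlim_real_sequentially filterlim_Suc])
    from eventually_compose_filterlim[OF A4[OF e2 \<delta>4 T] this]
    have "\<forall>\<^sub>F k in sequentially.
        limsup (\<lambda>n. ereal (measure (M n) {\<omega> \<in> space (M n). right (real (Suc k)) n \<omega>})) < ereal (\<delta> / 4) \<and>
        limsup (\<lambda>n. ereal (measure (M n) {\<omega> \<in> space (M n). left (real (Suc k)) n \<omega>})) < ereal (\<delta> / 4)"
      unfolding right_def left_def .
    moreover have "\<forall>\<^sub>F k in sequentially. max \<tau> T \<le> real k"
      using filterlim_real_sequentially unfolding filterlim_at_top by blast
    ultimately show ?thesis
    proof eventually_elim
      case (elim k)
      let ?c = "real (Suc k)"
      have c: "\<tau> \<le> ?c" "T \<le> ?c" using elim by auto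
      have "\<forall>\<^sub>F n in sequentially. measure (M n) {\<omega> \<in> space (M n). right ?c n \<omega>} < \<delta> / 4"
        "\<forall>\<^sub>F n in sequentially. measure (M n) {\<omega> \<in> space (M n). left ?c n \<omega>} < \<delta> / 4"
        using elim by (auto dest!: Limsup_lessD)
      \<comment> \<open>The rescaled domain must contain the window and also the interval on which
        \<open>near\<close> is stated, so that \<open>ext\<close> agrees with \<open>vt\<close> on
        both.\<close>
      moreover have "\<forall>\<^sub>F n in sequentially. {- max (real (Suc k0)) ?c..max (real (Suc k0)) ?c} \<subseteq> I n"
        unfolding I_def by (rule local_domain_eventually[OF t0 d0 d(3)])
      moreover have "\<forall>\<^sub>F n in sequentially. \<forall>s\<in>I n. \<bar>s\<bar> \<le> \<tau> \<longrightarrow> \<bar>g n s - b s\<bar> \<le> 1"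
        using \<tau> by (intro drift_ev) auto
      moreover have "\<forall>\<^sub>F n in sequentially. \<forall>s\<in>I n. \<bar>s\<bar> \<le> ?c \<longrightarrow> \<bar>g n s - b s\<bar> \<le> \<epsilon> / 2"
        using \<epsilon> by (intro drift_ev) auto
      ultimately show ?case
        using far_ev' near_ev
      proof eventually_elim
        case (elim n)
        interpret P: prob_space "M n" by (rule prob)
        have sub: "{- ?c..?c} \<subseteq> I n" and sub0: "{- real (Suc k0)..real (Suc k0)} \<subseteq> I n"
          by (rule order_trans[OF _ elim(3)], simp add: max_def)+
        let ?E = "{\<omega> \<in> space (M n). right ?c n \<omega>} \<union> {\<omega> \<in> space (M n). left ?c n \<omega>}
          \<union> ({\<omega> \<in> space (M n). \<not> far n \<omega>} \<union> {\<omega> \<in> space (M n). near n \<omega>})"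
        have far_meas': "{\<omega> \<in> space (M n). \<not> far n \<omega>} \<in> sets (M n)"
          using far_meas by measurable
        have good: "\<bar>G k (ext n \<omega>) - X n \<omega>\<bar> \<le> \<epsilon>" if \<omega>: "\<omega> \<in> space (M n)" "\<omega> \<notin> ?E" for \<omega>
        proof -
          have ext_vt: "ext n \<omega> s = vt n \<omega> s" if "s \<in> I n" for s
            using that by (simp add: ext_def)
          have y_far: "0 \<le> y n \<omega> s" if s: "s \<in> I n" "\<tau> \<le> \<bar>s\<bar>" for s
          proof -
            have "0 < (INF s\<in>{s\<in>I n. \<tau> \<le> \<bar>s\<bar>}. ereal (y n \<omega> s - \<kappa> * \<bar>s\<bar>))"
              using \<omega> by (simp add: far_def)
            also have "\<dots> \<le> ereal (y n \<omega> s - \<kappa> * \<bar>s\<bar>)" using s by (intro INF_lower) auto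
            finally have "\<kappa> * \<bar>s\<bar> < y n \<omega> s" by simp
            moreover have "0 \<le> \<kappa> * \<bar>s\<bar>" using \<kappa> by simp
            ultimately show ?thesis by linarith
          qed
          have y_near: "- (K + 1) \<le> y n \<omega> s" if s: "\<bar>s\<bar> \<le> \<tau>" for s
          proof -
            have sk: "\<bar>s\<bar> \<le> real (Suc k0)" using s k0 by simp
            then have "s \<in> {- real (Suc k0)..real (Suc k0)}" by auto
            then have sI: "s \<in> I n" using sub0 by blast
            have "\<bar>0 - ext n \<omega> s\<bar> \<le> unif_dist (Suc k0) (\<lambda>_. 0) (ext n \<omega>)"
              by (rule unif_dist_upper[OF _ ext_cadlag[OF \<omega>(1)] sk]) (simp add: cadlag_continuous)
            also have "\<dots> \<le> K" using \<omega> by (simp add: near_def)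
            finally have "- K \<le> vt n \<omega> s" by (simp add: ext_vt[OF sI])
            moreover have "\<bar>g n s - b s\<bar> \<le> 1" "0 \<le> b s"
              using elim(4) sI s A2(1) by (auto simp: b_def)
            ultimately show ?thesis by (simp add: y_def abs_le_iff)
          qed
          have y_right': "\<exists>u'. T \<le> u' \<and> u' \<le> ?c \<and> y n \<omega> u' / u' \<le> y n \<omega> u / u + e"
            if u: "u \<in> I n" "T \<le> u" for u
            using INF_diff_leD[where f="\<lambda>s. y n \<omega> s / s" and A="{s \<in> I n. T \<le> s \<and> s \<le> ?c}" and B="{s \<in> I n. T \<le> s}"
                and e="e / 2" and u=u and e'=e]
              u e \<omega> by (auto simp: right_def)
          have y_left': "\<exists>s'. - ?c \<le> s' \<and> s' \<le> - T \<and> y n \<omega> s / s - e \<le> y n \<omega> s' / s'"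
            if s: "s \<in> I n" "s \<le> - T" for s
            using SUP_diff_geD[where f="\<lambda>s. y n \<omega> s / s" and A="{s \<in> I n. - ?c \<le> s \<and> s \<le> - T}" and B="{s \<in> I n. s \<le> - T}"
                and e="e / 2" and u=s and e'=e]
              s e \<omega> by (auto simp: left_def)
          let ?H = "gcm {- ?c..?c} (y n \<omega>) 0"
          have low: "?H - \<epsilon> / 2 \<le> chord (y n \<omega>) 0 s u" if su: "(s, u) \<in> chord_pairs (I n) 0" for s u
          proof -
            have "?H - (\<tau> * e + (K + 1) * \<tau> / (T + \<tau>)) \<le> chord (y n \<omega>) 0 s u"
              by (rule gcm_localization[OF sub c \<tau> T _ _ y0 y_far y_near y_right' y_left' su])
                (use K e in auto)
            then show ?thesis using loss by linarith
          qed
          \<comment> \<open>By \<open>low\<close>, the chords over \<open>I n\<close> have a common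
            lower bound, so neither minorant is a default value.\<close>
          have X: "X n \<omega> = gcm (I n) (y n \<omega>) 0"
            using gcm_local_domain[OF J t0 d0 a y low[unfolded I_def]] by (simp add: X_def I_def a_def)
          \<comment> \<open>Restricting to the window costs at most \<open>\<epsilon> / 2\<close>,
            and replacing the drift by \<open>b\<close> there costs at most another
            \<open>\<epsilon> / 2\<close>.\<close>
          have "?H - \<epsilon> / 2 \<le> X n \<omega>"
            unfolding X by (intro gcm_greatest II low)
          moreover have "X n \<omega> \<le> ?H"
            unfolding X by (rule gcm_antimono[OF sub is_interval_cc II(1) int low])
          moreover have "\<bar>?H - G k (ext n \<omega>)\<bar> \<le> \<epsilon> / 2"
            unfolding G_def
          proof (rule gcm_dist_le[OF is_interval_cc int])
            fix s assume s: "s \<in> {- ?c..?c}"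
            then have sI: "s \<in> I n" using sub by blast
            show "- (K + 1) \<le> y n \<omega> s"
              using y_near[of s] y_far[OF sI] K by (cases "\<bar>s\<bar> \<le> \<tau>") auto
            have "\<bar>s\<bar> \<le> ?c" using s by auto
            then show "\<bar>y n \<omega> s - (b s + ext n \<omega> s)\<bar> \<le> \<epsilon> / 2"
              using elim(5) sI by (simp add: y_def ext_vt[OF sI])
          qed
          ultimately show ?thesis using \<epsilon> by linarith
        qed
        have "measure (M n) {\<omega> \<in> space (M n). \<epsilon> < \<bar>G k (ext n \<omega>) - X n \<omega>\<bar>} \<le> measure (M n) ?E"
        proof (rule P.finite_measure_mono)
          show "{\<omega> \<in> space (M n). \<epsilon> < \<bar>G k (ext n \<omega>) - X n \<omega>\<bar>} \<subseteq> ?E"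
            using good by (auto simp: not_le[symmetric])
          show "?E \<in> sets (M n)"
            by (intro sets.Un right_meas left_meas far_meas' near_meas)
        qed
        also have "\<dots> \<le> (measure (M n) {\<omega> \<in> space (M n). right ?c n \<omega>} + measure (M n) {\<omega> \<in> space (M n). left ?c n \<omega>})
          + (measure (M n) {\<omega> \<in> space (M n). \<not> far n \<omega>} + measure (M n) {\<omega> \<in> space (M n). near n \<omega>})"
          by (intro order_trans[OF measure_Un_le] add_mono measure_Un_le
              sets.Un right_meas left_meas far_meas' near_meas)
        also have "\<dots> < \<delta>"
          using elim(1,2,6,7) by (simp add: near_def)
        finally show ?case .
      qed
    qed
  qed

  \<comment> \<open>Letting the window grow\<close>
  have "weak_conv_m (\<lambda>n. distr (M n) borel (X n)) (distr N borel Y)"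
  proof (rule weak_conv_m_approximation[where Z="\<lambda>k n \<omega>. G k (ext n \<omega>)" and W="\<lambda>k \<omega>. G k (vlim \<omega>)"])
    show "(\<lambda>\<omega>. G k (ext n \<omega>)) \<in> borel_measurable (M n)" for k n
      by (rule measurable_compose[OF ext_meas G_meas])
    show "(\<lambda>\<omega>. G k (vlim \<omega>)) \<in> borel_measurable N" for k
      by (rule measurable_compose[OF vlim_meas G_meas])
    show "AE \<omega> in N. (\<lambda>k. G k (vlim \<omega>)) \<longlonglongrightarrow> Y \<omega>"
      using finite
    proof eventually_elim
      case (elim \<omega>)
      from gcm_intervals_tendsto[OF this] show ?case by (simp only: G_def Y_def b_def)
    qed
  qed (fact prob X_meas Y_meas ZW ZX)+
  then show ?thesis using X_meas Y_meas by blast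
qed

end
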